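(* Let $\Omega_R$ be the regular region of an eternally expanding, $K<0$ McVittie spacetime, and let $(t_0,r_0)\in\Omega_R$. Then there exists $s_\omega<+\infty$ such that $\lim_{s\to s_\omega^-}(t(s),r_{IRNG}(s))=(+\infty,r_-)$, where $s\mapsto(t(s),r_{IRNG}(s))$ is the unique (affinely parametrised) ingoing radial null geodesic with initial point $(t(0),r_{IRNG}(0))=(t_0,r_0)$.
   Context: Setting: $M>0$, $\Lambda\in\mathbb{R}$ (necessarily $\Lambda\ge0$ here), $K=-1$ (normalisation of $K<0$), scale factor $a:(0,+\infty)\to\mathbb{R}_+$, $H=a'/a$, $\kappa(t,r)=1-\frac{2M}{r}+\frac{r^2}{a^2(t)}$; $r_1(t)$ is the unique positive zero of $\kappa(t,\cdot)$; $\Omega=\{(t,r):t>0,\ r>r_1(t)\}$. The spacetime is $\Omega\times\mathbb{S}^2$ with $$ds^2=-\sigma^2(H^{-2}-r^2\kappa^{-1})dt^2-2\sigma r\kappa^{-1}dt\,dr+\kappa^{-1}dr^2+r^2d\omega^2,\qquad \sigma=\frac{H}{a^2}\kappa^{1/2}\int_r^\infty\bar r\,\kappa^{-3/2}(t,\bar r)\,d\bar r.$$ "Eternally expanding McVittie spacetime" means: $H(t)>0$ for all $t>0$ and (i) $a\in C^2((0,\infty),\mathbb{R}_+)$; (ii) $\lim_{t\to0^+}a=0$; (iii) $\mu_{FLRW}>0$, $\mu_{FLRW}+P_{FLRW}>0$, $\mu_{FLRW}+3P_{FLRW}>0$ for all $t>0$, where $8\pi\mu_{FLRW}+\Lambda=3(H^2+Ka^{-2})$,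 $8\pi P_{FLRW}-\Lambda=-2H'-3H^2-Ka^{-2}$; (iv) $\lim_{a\to0^+}aH=+\infty$ and $(aH)^2\sim-K+\frac\Lambda3a^2$ as $a\to+\infty$. Then $a\to+\infty$ and $H\to H_0\ge0$ as $t\to+\infty$, with $\Lambda=3H_0^2$. Standing assumption: if $H_0>0$ then $MH_0<\frac{1}{3\sqrt3}$. The radius $r_-$ is defined as $2M$ if $H_0=0$, and as the smaller positive root of $1-\frac{2M}{r}-r^2H_0^2=0$ if $H_0>0$. The regular region is $\Omega_R=\{(t,r)\in\Omega:\chi(t,r)>0\}$, $\chi=\kappa-r^2H^2$. Ingoing radial null geodesics are null geodesics with constant angular coordinates satisfying, in the $(t,r)$-plane, $\frac{dr}{dt}=\sigma(r-\kappa^{1/2}H^{-1})$. The affine parameter $s$ is oriented so that $t$ increases with $s$. *)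

theory Defs
  imports "HOL-Analysis.Analysis" "HOL-Library.Landau_Symbols"
begin

section \<open>Geodesics in a coordinate domain\<close>

definition partial_deriv :: "(real^'n \<Rightarrow> real) \<Rightarrow> 'n \<Rightarrow> real^'n \<Rightarrow> real" where
  "partial_deriv f i x = deriv (\<lambda>h. f (x + h *\<^sub>R axis i 1)) 0"

definition christoffel :: "(real^'n \<Rightarrow> real^'n^'n) \<Rightarrow> real^'n \<Rightarrow> 'n \<Rightarrow> 'n \<Rightarrow> 'n \<Rightarrow> real" where
  "christoffel g x i j k =
     1/2 * (\<Sum>l\<in>UNIV. matrix_inv (g x) $ i $ l *
       (partial_deriv (\<lambda>y. g y $ l $ k) j x + partial_deriv (\<lambda>y. g y $ l $ j) k x
         - partial_deriv (\<lambda>y. g y $ j $ k) l x))"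

text \<open>An affinely parametrised geodesic, with velocity \<open>u\<close>, of the metric \<open>g\<close> on the
  coordinate domain \<open>U\<close>; derivatives are one-sided at an endpoint belonging to \<open>I\<close>.\<close>

definition geodesic_on ::
  "(real^'n \<Rightarrow> real^'n^'n) \<Rightarrow> (real^'n) set \<Rightarrow> real set \<Rightarrow> (real \<Rightarrow> real^'n) \<Rightarrow> (real \<Rightarrow> real^'n) \<Rightarrow> bool"
where
  "geodesic_on g U I \<gamma> u \<longleftrightarrow>
     (\<forall>s\<in>I. \<gamma> s \<in> U \<and>
        (\<gamma> has_vector_derivative u s) (at s within I) \<and>
        (u has_vector_derivative
           (\<chi> i. - (\<Sum>j\<in>UNIV. \<Sum>k\<in>UNIV. christoffel g (\<gamma> s) i j k * u s $ j * u s $ k)))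
          (at s within I))"


section \<open>McVittie spacetimes with \<open>K = -1\<close>\<close>

text \<open>The scale factor \<open>a\<close> is a total function of which only the values on \<open>{0<..}\<close> matter.\<close>

definition hubble :: "(real \<Rightarrow> real) \<Rightarrow> real \<Rightarrow> real" where
  "hubble a t = deriv a t / a t"

definition kappa :: "real \<Rightarrow> (real \<Rightarrow> real) \<Rightarrow> real \<Rightarrow> real \<Rightarrow> real" where
  "kappa M a t r = 1 - 2 * M / r + r\<^sup>2 / (a t)\<^sup>2"

definition r1 :: "real \<Rightarrow> (real \<Rightarrow> real) \<Rightarrow> real \<Rightarrow> real" where
  "r1 M a t = (THE r. 0 < r \<and> kappa M a t r = 0)"

definition Omega :: "real \<Rightarrow> (real \<Rightarrow> real) \<Rightarrow> (real \<times> real) set" where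
  "Omega M a = {(t, r). 0 < t \<and> r1 M a t < r}"

definition sigma :: "real \<Rightarrow> (real \<Rightarrow> real) \<Rightarrow> real \<Rightarrow> real \<Rightarrow> real" where
  "sigma M a t r = hubble a t / (a t)\<^sup>2 * sqrt (kappa M a t r)
     * integral {r..} (\<lambda>\<rho>. \<rho> * kappa M a t \<rho> powr (-3/2))"

text \<open>Coordinates are \<open>x = (t, r, \<theta>, \<phi>)\<close> with \<open>d\<omega>\<^sup>2 = d\<theta>\<^sup>2 + sin\<^sup>2 \<theta> d\<phi>\<^sup>2\<close>.  Every point
  of the sphere lies in such a chart after a rotation.\<close>

definition mcvittie_domain :: "real \<Rightarrow> (real \<Rightarrow> real) \<Rightarrow> (real^4) set" where
  "mcvittie_domain M a = {x. (x $ 1, x $ 2) \<in> Omega M a \<and> 0 < x $ 3 \<and> x $ 3 < pi}"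

definition mcvittie_metric :: "real \<Rightarrow> (real \<Rightarrow> real) \<Rightarrow> real^4 \<Rightarrow> real^4^4" where
  "mcvittie_metric M a x =
     (let t = x $ 1; r = x $ 2; \<theta> = x $ 3;
          \<kappa> = kappa M a t r; \<sigma> = sigma M a t r; H = hubble a t
      in vector
        [vector [- \<sigma>\<^sup>2 * (1 / H\<^sup>2 - r\<^sup>2 / \<kappa>), - \<sigma> * r / \<kappa>, 0, 0],
         vector [- \<sigma> * r / \<kappa>, 1 / \<kappa>, 0, 0],
         vector [0, 0, r\<^sup>2, 0],
         vector [0, 0, 0, r\<^sup>2 * (sin \<theta>)\<^sup>2]])"

text \<open>Solutions of \<open>8\<pi>\<mu> + \<Lambda> = 3(H\<^sup>2 + K a\<^sup>-\<^sup>2)\<close> and \<open>8\<pi>P - \<Lambda> = -2H' - 3H\<^sup>2 - K a\<^sup>-\<^sup>2\<close>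
  for \<open>K = -1\<close>.\<close>

definition mu_FLRW :: "real \<Rightarrow> (real \<Rightarrow> real) \<Rightarrow> real \<Rightarrow> real" where
  "mu_FLRW \<Lambda> a t = (3 * ((hubble a t)\<^sup>2 - 1 / (a t)\<^sup>2) - \<Lambda>) / (8 * pi)"

definition P_FLRW :: "real \<Rightarrow> (real \<Rightarrow> real) \<Rightarrow> real \<Rightarrow> real" where
  "P_FLRW \<Lambda> a t =
     (- 2 * deriv (hubble a) t - 3 * (hubble a t)\<^sup>2 + 1 / (a t)\<^sup>2 + \<Lambda>) / (8 * pi)"

text \<open>Since \<open>a\<close> increases from 0 to infinity (unboundedness follows from
  \<open>4\<pi>(\<mu> + P) = -H' - a\<^sup>-\<^sup>2 > 0\<close> and \<open>H > 0\<close>), the limits as \<open>a\<close> tends to 0 and to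
  infinity are expressed as limits in \<open>t\<close>.\<close>

definition eternally_expanding_mcvittie :: "real \<Rightarrow> real \<Rightarrow> (real \<Rightarrow> real) \<Rightarrow> bool" where
  "eternally_expanding_mcvittie M \<Lambda> a \<longleftrightarrow>
     0 < M \<and>
     (\<forall>t>0. 0 < a t) \<and>
     (\<forall>t>0. 0 < hubble a t) \<and>
     (\<forall>t>0. a differentiable (at t)) \<and>
     (\<forall>t>0. deriv a differentiable (at t)) \<and>
     continuous_on {0<..} (deriv (deriv a)) \<and>
     (a \<longlongrightarrow> 0) (at_right 0) \<and>
     (\<forall>t>0. 0 < mu_FLRW \<Lambda> a t) \<and>
     (\<forall>t>0. 0 < mu_FLRW \<Lambda> a t + P_FLRW \<Lambda> a t) \<and>
     (\<forall>t>0. 0 < mu_FLRW \<Lambda> a t + 3 * P_FLRW \<Lambda> a t) \<and>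
     filterlim (\<lambda>t. a t * hubble a t) at_top (at_right 0) \<and>
     (\<lambda>t. (a t * hubble a t)\<^sup>2) \<sim>[at_top] (\<lambda>t. 1 + \<Lambda> / 3 * (a t)\<^sup>2)"

definition H_inf :: "(real \<Rightarrow> real) \<Rightarrow> real" where
  "H_inf a = Lim at_top (hubble a)"

definition r_minus :: "real \<Rightarrow> (real \<Rightarrow> real) \<Rightarrow> real" where
  "r_minus M a =
     (if H_inf a = 0 then 2 * M
      else (LEAST r. 0 < r \<and> 1 - 2 * M / r - r\<^sup>2 * (H_inf a)\<^sup>2 = 0))"

definition regular_region :: "real \<Rightarrow> (real \<Rightarrow> real) \<Rightarrow> (real \<times> real) set" where
  "regular_region M a =
     {(t, r) \<in> Omega M a. 0 < kappa M a t r - r\<^sup>2 * (hubble a t)\<^sup>2}"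

text \<open>Affinely parametrised ingoing radial null geodesics with future-directed parameter;
  the equation for \<open>dr/dt\<close> is written as \<open>dr/ds = (dr/dt) dt/ds\<close>.\<close>

definition ingoing_radial_null_geodesic_on ::
  "real \<Rightarrow> (real \<Rightarrow> real) \<Rightarrow> real set \<Rightarrow> (real \<Rightarrow> real^4) \<Rightarrow> (real \<Rightarrow> real^4) \<Rightarrow> bool" where
  "ingoing_radial_null_geodesic_on M a I \<gamma> u \<longleftrightarrow>
     geodesic_on (mcvittie_metric M a) (mcvittie_domain M a) I \<gamma> u \<and>
     (\<forall>s\<in>I. u s \<bullet> (mcvittie_metric M a (\<gamma> s) *v u s) = 0) \<and>
     (\<forall>s\<in>I. \<forall>s'\<in>I. \<gamma> s $ 3 = \<gamma> s' $ 3 \<and> \<gamma> s $ 4 = \<gamma> s' $ 4) \<and>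
     (\<forall>s\<in>I. 0 < u s $ 1) \<and>
     (\<forall>s\<in>I. let t = \<gamma> s $ 1; r = \<gamma> s $ 2
        in u s $ 2 = sigma M a t r * (r - sqrt (kappa M a t r) / hubble a t) * u s $ 1)"

end

theory Submission
  imports Defs
begin

text \<open>Along an ingoing radial null geodesic \<open>r'' = -4\<pi>(\<mu> + P) r (u \<cdot> k)\<^sup>2 < 0\<close>, so \<open>r\<close> is a
  concave function of the affine parameter.  In the regular region \<open>dr/ds\<close> is negative, hence
  bounded away from 0, while \<open>r > 2M\<close>; so the parameter range is finite.  With
  \<open>N = H\<^sup>2 - a\<^sup>-\<^sup>2\<close> one has \<open>\<chi> = 1 - 2M/r - r\<^sup>2 N\<close>, and \<open>\<mu> + P > 0\<close> makes \<open>N\<close> strictly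
  decreasing to \<open>H\<^sub>0\<^sup>2\<close>: the regular region grows with \<open>t\<close>, no solution of the equation for
  \<open>dr/dt\<close> can leave it, and \<open>r\<close> decreases to a zero of \<open>1 - 2M/r - r\<^sup>2 H\<^sub>0\<^sup>2\<close>, since otherwise
  \<open>dr/dt\<close> would have a negative limit.  This zero lies below \<open>r\<^sub>0\<close>, where that concave function
  is positive, so it is \<open>r\<^sub>-\<close>.\<close>

section \<open>Ordinary differential equations on the half-line\<close>

text \<open>The metric contains \<open>sigma\<close>, an improper integral, and the geodesic
  equation differentiates it. In terms of \<open>J\<close> = sigma / (H sqrt(kappa)) the (t, r)
  block of the metric has determinant -J^2, and along an ingoing null ray the t-derivative of
  \<open>J\<close> cancels from the radial geodesic equation.

  For this reason the geodesic system is not solved as a system. The scalar equation for r as a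
  function of t comes first and needs a Lipschitz bound in r only. Along its solution the radial
  geodesic equation is a linear equation for dr/ds as a function of t, solved by an exponential;
  dt/ds is the quotient of dr/ds by dr/dt, and s as a function of t is the integral of the
  reciprocal. The time component of the geodesic equation follows by differentiating that quotient.
  Uniqueness is proved for the same three quantities.

  The limit of \<open>J\<close> for large t is not computed. The lower bound 1 / sqrt(1 + r^2 /
  a^2), which tends to 1 for bounded r, is enough to keep dr/dt below a negative constant when r
  stops short of a zero.\<close>

lemma mvt_within:
  fixes f :: "real \<Rightarrow> real"
  assumes "x < y" "{x..y} \<subseteq> S"
    and "\<And>t. t \<in> {x..y} \<Longrightarrow> (f has_real_derivative f' t) (at t within S)"
  obtains z where "x < z" "z < y" "f y - f x = f' z * (y - x)"
proof -
  have "\<exists>z\<in>{x<..<y}. f y - f x = f' z * (y - x)"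
  proof (rule mvt_simple[OF assms(1)])
    fix t assume "x \<le> t" "t \<le> y"
    then show "(f has_derivative (\<lambda>h. f' t * h)) (at t within {x..y})"
      using assms(2,3) by (meson atLeastAtMost_iff has_field_derivative_def has_field_derivative_subset)
  qed
  with that show thesis by auto
qed

lemma has_real_derivative_integral_atLeast:
  fixes h :: "real \<Rightarrow> real"
  assumes "continuous_on {c..} h" "c \<le> t"
  shows "((\<lambda>t. integral {c..t} h) has_real_derivative h t) (at t within {c..})"
proof -
  have "((\<lambda>t. integral {c..t} h) has_real_derivative h t) (at t within {c..t+1})"
    by (rule integral_has_real_derivative) (use assms in \<open>auto intro: continuous_on_subset\<close>)
  also have "at t within {c..t+1} = at t within {c..}"
    by (rule at_within_nhd[where S="{..<t+1}"]) auto
  finally show ?thesis .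
qed

text \<open>The Lipschitz constant may grow with T, but the iterates \<open>X n\<close> live on the
  whole half-line and do not depend on T. They converge uniformly on each \<open>{c..T}\<close>, so
  the pointwise limit is a global solution and no local solutions have to be glued.\<close>

lemma picard_global:
  fixes F :: "real \<Rightarrow> real \<Rightarrow> real"
  assumes cont: "continuous_on ({c..} \<times> UNIV) (\<lambda>(t, x). F t x)"
    and lip: "\<And>T. c \<le> T \<Longrightarrow> \<exists>L. \<forall>t\<in>{c..T}. \<forall>x y. \<bar>F t x - F t y\<bar> \<le> L * \<bar>x - y\<bar>"
  shows "\<exists>x. x c = x\<^sub>0 \<and> (\<forall>t\<ge>c. (x has_real_derivative F t (x t)) (at t within {c..}))"
proof -
  define X where "X = rec_nat (\<lambda>t. x\<^sub>0) (\<lambda>n g t. x\<^sub>0 + integral {c..t} (\<lambda>\<tau>. F \<tau> (g \<tau>)))"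
  have X0: "X 0 = (\<lambda>t. x\<^sub>0)" and XS: "X (Suc n) = (\<lambda>t. x\<^sub>0 + integral {c..t} (\<lambda>\<tau>. F \<tau> (X n \<tau>)))" for n
    by (simp_all add: X_def)
  have Fcont: "continuous_on A (\<lambda>\<tau>. F \<tau> (g \<tau>))" if "continuous_on A g" "A \<subseteq> {c..}" for A g
  proof -
    have "continuous_on A (\<lambda>\<tau>. (\<lambda>(t, x). F t x) (\<tau>, g \<tau>))"
      by (rule continuous_on_compose2[OF cont]) (use that in \<open>auto intro!: continuous_intros\<close>)
    then show ?thesis by simp
  qed
  have Xcont: "continuous_on {c..} (X n)" for n
  proof (induction n)
    case (Suc n)
    have "((\<lambda>t. integral {c..t} (\<lambda>\<tau>. F \<tau> (X n \<tau>))) has_real_derivative F t (X n t)) (at t within {c..})"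
      if "c \<le> t" for t
      using has_real_derivative_integral_atLeast[OF Fcont[OF Suc]] that by simp
    then have "continuous_on {c..} (\<lambda>t. integral {c..t} (\<lambda>\<tau>. F \<tau> (X n \<tau>)))"
      by (intro DERIV_continuous_on[where D="\<lambda>t. F t (X n t)"]) simp
    then show ?case unfolding XS by (rule continuous_on_add[OF continuous_on_const])
  qed (simp add: X0)
  have int: "(\<lambda>\<tau>. F \<tau> (X n \<tau>)) integrable_on {c..t}" for n t
    by (intro integrable_continuous_real Fcont continuous_on_subset[OF Xcont]) auto
  have unif: "uniform_limit {c..T} X (\<lambda>t. lim (\<lambda>n. X n t)) sequentially" if cT: "c \<le> T" for T
  proof -
    obtain L' where L': "\<And>t x y. t \<in> {c..T} \<Longrightarrow> \<bar>F t x - F t y\<bar> \<le> L' * \<bar>x - y\<bar>"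
      using lip[OF cT] by blast
    \<comment> \<open>Made positive, so that the exponential weight below is at least 1 and
      increasing.\<close>
    define L where "L = max L' 1"
    have L: "\<bar>F t x - F t y\<bar> \<le> L * \<bar>x - y\<bar>" if "t \<in> {c..T}" for t x y
      using L'[OF that, of x y] mult_right_mono[of L' L "\<bar>x - y\<bar>"] by (simp add: L_def)
    have "L > 0" by (simp add: L_def)
    have "compact ((\<lambda>\<tau>. F \<tau> x\<^sub>0) ` {c..T})"
      by (intro compact_continuous_image Fcont) auto
    then obtain B where B: "\<And>\<tau>. \<tau> \<in> {c..T} \<Longrightarrow> \<bar>F \<tau> x\<^sub>0\<bar> \<le> B"
      using compact_imp_bounded bounded_iff by (metis imageI real_norm_def)
    have "B \<ge> 0" using B[of c] that by auto
    define K where "K = B * (T - c)"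
    have "K \<ge> 0" using \<open>B \<ge> 0\<close> that by (simp add: K_def)
    \<comment> \<open>A Lipschitz step costs a factor L, integrating the weight exp (2 L (t - c))
      gains 1 / (2 L); so each iteration halves the bound.\<close>
    have step: "\<bar>X (Suc n) t - X n t\<bar> \<le> K * (1/2)^n * exp (2 * L * (t - c))" if "t \<in> {c..T}" for n t
      using that
    proof (induction n arbitrary: t)
      case 0
      have "\<bar>integral {c..t} (\<lambda>\<tau>. F \<tau> x\<^sub>0)\<bar> \<le> B * (t - c)"
        using integral_bound[of c t "\<lambda>\<tau>. F \<tau> x\<^sub>0" B] Fcont[OF continuous_on_const, of "{c..t}" x\<^sub>0] 0 B
        by auto
      also have "\<dots> \<le> K" using 0 \<open>B \<ge> 0\<close> by (auto simp: K_def intro!: mult_left_mono)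
      also have "\<dots> \<le> K * exp (2 * L * (t - c))"
        using \<open>K \<ge> 0\<close> \<open>L > 0\<close> 0 by (simp add: mult_le_cancel_left1)
      finally show ?case by (simp add: XS X0)
    next
      case (Suc n)
      let ?e = "\<lambda>\<tau>. L * (K * (1/2)^n * exp (2 * L * (\<tau> - c)))"
      have e: "(?e has_integral (K * (1/2)^Suc n * exp (2 * L * (t - c)) - K * (1/2)^Suc n * exp (2 * L * (c - c)))) {c..t}"
        using Suc.prems
        by (intro fundamental_theorem_of_calculus)
          (auto intro!: derivative_eq_intros simp flip: has_real_derivative_iff_has_vector_derivative)
      have "X (Suc (Suc n)) t - X (Suc n) t = integral {c..t} (\<lambda>\<tau>. F \<tau> (X (Suc n) \<tau>) - F \<tau> (X n \<tau>))"
        by (subst Henstock_Kurzweil_Integration.integral_diff[OF int int]) (simp add: XS)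
      also have "\<bar>\<dots>\<bar> \<le> integral {c..t} ?e"
      proof -
        have "norm (integral {c..t} (\<lambda>\<tau>. F \<tau> (X (Suc n) \<tau>) - F \<tau> (X n \<tau>))) \<le> integral {c..t} ?e"
        proof (rule integral_norm_bound_integral)
          show "(\<lambda>\<tau>. F \<tau> (X (Suc n) \<tau>) - F \<tau> (X n \<tau>)) integrable_on {c..t}"
            by (intro Henstock_Kurzweil_Integration.integrable_diff int)
          show "?e integrable_on {c..t}" using e by blast
          fix \<tau> assume \<tau>: "\<tau> \<in> {c..t}"
          then have "\<tau> \<in> {c..T}" using Suc.prems by auto
          then show "norm (F \<tau> (X (Suc n) \<tau>) - F \<tau> (X n \<tau>)) \<le> ?e \<tau>"
            using L[of \<tau> "X (Suc n) \<tau>" "X n \<tau>"] Suc.IH[of \<tau>] \<open>L > 0\<close>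
            by (smt (verit) mult_left_mono real_norm_def)
        qed
        then show ?thesis by simp
      qed
      also have "\<dots> \<le> K * (1/2)^Suc n * exp (2 * L * (t - c))"
        unfolding integral_unique[OF e] using \<open>K \<ge> 0\<close> by simp
      finally show ?case .
    qed
    have bound: "norm (X (Suc n) t - X n t) \<le> (K * exp (2 * L * (T - c))) * (1/2)^n" if "t \<in> {c..T}" for n t
    proof -
      have "K * (1/2)^n * exp (2 * L * (t - c)) \<le> K * (1/2)^n * exp (2 * L * (T - c))"
        using \<open>K \<ge> 0\<close> \<open>L > 0\<close> that by (intro mult_left_mono) auto
      with step[OF that, of n] show ?thesis by (simp add: mult_ac)
    qed
    have "uniform_limit {c..T} (\<lambda>n t. \<Sum>i<n. X (Suc i) t - X i t) (\<lambda>t. \<Sum>i. X (Suc i) t - X i t) sequentially"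
      by (rule Weierstrass_m_test[OF bound]) (auto intro!: summable_mult summable_geometric)
    then have "uniform_limit {c..T} (\<lambda>n t. X n t - X 0 t) (\<lambda>t. \<Sum>i. X (Suc i) t - X i t) sequentially"
      by (simp add: sum_lessThan_telescope[of "\<lambda>n. X n t" for t])
    then have "uniform_limit {c..T} (\<lambda>n t. x\<^sub>0 + (X n t - X 0 t)) (\<lambda>t. x\<^sub>0 + (\<Sum>i. X (Suc i) t - X i t)) sequentially"
      by (intro uniform_limit_intros)
    then have *: "uniform_limit {c..T} X (\<lambda>t. x\<^sub>0 + (\<Sum>i. X (Suc i) t - X i t)) sequentially"
      by (simp add: X0)
    show ?thesis
    proof (rule uniform_limit_cong'[THEN iffD1, OF refl _ *])
      fix t assume "t \<in> {c..T}"
      then show "x\<^sub>0 + (\<Sum>i. X (Suc i) t - X i t) = lim (\<lambda>n. X n t)"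
        using tendsto_uniform_limitI[OF *] by (metis limI)
    qed
  qed
  define x where "x = (\<lambda>t. lim (\<lambda>n. X n t))"
  have xcontT: "continuous_on {c..T} x" for T
  proof (cases "c \<le> T")
    case True
    show ?thesis unfolding x_def
      by (rule uniform_limit_theorem[OF _ unif[OF True]])
        (auto intro!: always_eventually continuous_on_subset[OF Xcont])
  qed simp
  have xint: "x t = x\<^sub>0 + integral {c..t} (\<lambda>\<tau>. F \<tau> (x \<tau>))" if t: "c \<le> t" for t
  proof -
    obtain L where L: "\<And>\<tau> x y. \<tau> \<in> {c..t} \<Longrightarrow> \<bar>F \<tau> x - F \<tau> y\<bar> \<le> L * \<bar>x - y\<bar>"
      using lip[OF t] by blast
    have "uniform_limit {c..t} (\<lambda>n \<tau>. F \<tau> (X n \<tau>)) (\<lambda>\<tau>. F \<tau> (x \<tau>)) sequentially"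
    proof (rule uniform_limitI)
      fix e :: real assume "e > 0"
      then have "e / (\<bar>L\<bar> + 1) > 0" by simp
      from uniform_limitD[OF unif[OF t] this]
      show "\<forall>\<^sub>F n in sequentially. \<forall>\<tau>\<in>{c..t}. dist (F \<tau> (X n \<tau>)) (F \<tau> (x \<tau>)) < e"
      proof (eventually_elim, safe)
        fix n \<tau> assume *: "\<forall>x\<in>{c..t}. dist (X n x) (lim (\<lambda>n. X n x)) < e / (\<bar>L\<bar> + 1)" and \<tau>: "\<tau> \<in> {c..t}"
        have d: "\<bar>X n \<tau> - x \<tau>\<bar> < e / (\<bar>L\<bar> + 1)" using * \<tau> by (auto simp: x_def dist_real_def)
        have "\<bar>F \<tau> (X n \<tau>) - F \<tau> (x \<tau>)\<bar> \<le> L * \<bar>X n \<tau> - x \<tau>\<bar>" using L[OF \<tau>] .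
        also have "\<dots> \<le> (\<bar>L\<bar> + 1) * \<bar>X n \<tau> - x \<tau>\<bar>" by (intro mult_right_mono) auto
        also have "\<dots> < e" using d by (simp add: field_simps)
        finally show "dist (F \<tau> (X n \<tau>)) (F \<tau> (x \<tau>)) < e" by (simp add: dist_real_def)
      qed
    qed
    then obtain I J where IJ: "\<And>n. ((\<lambda>\<tau>. F \<tau> (X n \<tau>)) has_integral I n) {c..t}"
      "((\<lambda>\<tau>. F \<tau> (x \<tau>)) has_integral J) {c..t}" "I \<longlonglongrightarrow> J"
    proof (rule uniform_limit_integral)
      show "continuous_on {c..t} (\<lambda>\<tau>. F \<tau> (X n \<tau>))" for n
        by (intro Fcont continuous_on_subset[OF Xcont]) auto
    qed auto
    have "X (Suc n) t = x\<^sub>0 + I n" for n using IJ(1)[of n] by (simp add: XS integral_unique)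
    then have "(\<lambda>n. X (Suc n) t) \<longlonglongrightarrow> x\<^sub>0 + J" by (simp add: IJ(3) tendsto_add)
    moreover have "(\<lambda>n. X (Suc n) t) \<longlonglongrightarrow> x t"
      using LIMSEQ_Suc[OF tendsto_uniform_limitI[OF unif[OF t], of t]] t by (simp add: x_def)
    ultimately show ?thesis using IJ(2) by (metis LIMSEQ_unique integral_unique)
  qed
  have xcont: "continuous_on {c..} x"
  proof -
    have "continuous (at t within {c..}) x" if "c \<le> t" for t
    proof -
      have "continuous (at t within {c..t+1}) x"
        using xcontT[of "t+1"] that by (simp add: continuous_on_eq_continuous_within)
      also have "at t within {c..t+1} = at t within {c..}"
        by (rule at_within_nhd[where S="{..<t+1}"]) auto
      finally show ?thesis .
    qed
    then show ?thesis by (simp add: continuous_on_eq_continuous_within)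
  qed
  show ?thesis
  proof (intro exI[of _ x] conjI allI impI)
    show "x c = x\<^sub>0" using xint[of c] by simp
    fix t assume t: "c \<le> t"
    have "((\<lambda>t. x\<^sub>0 + integral {c..t} (\<lambda>\<tau>. F \<tau> (x \<tau>))) has_real_derivative F t (x t)) (at t within {c..})"
      using has_real_derivative_integral_atLeast[OF Fcont[OF xcont] t]
      by (auto intro!: derivative_eq_intros)
    then show "(x has_real_derivative F t (x t)) (at t within {c..})"
      by (rule has_field_derivative_transform_within[where d=1]) (use t xint in auto)
  qed
qed

text \<open>The function D^2 exp (- 2 L s) starts at 0 and has nonpositive derivative. Squaring D
  avoids a case distinction on its sign.\<close>

lemma gronwall_zero:
  fixes D :: "real \<Rightarrow> real"
  assumes D: "\<And>s. s \<in> {0..c} \<Longrightarrow> (D has_real_derivative D' s) (at s within {0..c})"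
    and le: "\<And>s. s \<in> {0..c} \<Longrightarrow> \<bar>D' s\<bar> \<le> L * \<bar>D s\<bar>"
    and "D 0 = 0" "s \<in> {0..c}"
  shows "D s = 0"
proof (cases "s = 0")
  case False
  then have "0 < s" using assms(4) by auto
  let ?E = "\<lambda>s. (D s)\<^sup>2 * exp (- 2 * L * s)"
  let ?E' = "\<lambda>s. (2 * D s * D' s - 2 * L * (D s)\<^sup>2) * exp (- 2 * L * s)"
  have "(?E has_real_derivative ?E' t) (at t within {0..c})" if "t \<in> {0..s}" for t
    using assms(4) that
    by (auto intro!: derivative_eq_intros D simp: algebra_simps power2_eq_square)
  from mvt_within[OF \<open>0 < s\<close> _ this]
  obtain z where z: "0 < z" "z < s" "?E s - ?E 0 = ?E' z * (s - 0)"
    using assms(4) by auto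
  have "D z * D' z \<le> \<bar>D z\<bar> * \<bar>D' z\<bar>" by (metis abs_ge_self abs_mult)
  also have "\<dots> \<le> \<bar>D z\<bar> * (L * \<bar>D z\<bar>)" using le[of z] z assms(4) by (intro mult_left_mono) auto
  also have "\<dots> = L * (D z)\<^sup>2" by (simp add: power2_eq_square mult_ac)
  finally have "?E' z * s \<le> 0" using \<open>0 < s\<close> by (simp add: mult_nonpos_nonneg)
  with z(3) \<open>D 0 = 0\<close> have "?E s \<le> 0" by simp
  then show ?thesis by (metis exp_gt_zero linorder_not_less mult_pos_pos zero_less_power2)
qed (use assms in simp)

text \<open>\<open>S\<close> is the antiderivative of h vanishing at c and \<open>T\<close> its
  inverse. Comparison with G gives S t <= C - G c, so the supremum w of S is finite; strict growth
  keeps it from being attained. With h = ds/dt this turns time into an affine parameter of finite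
  range.\<close>

lemma time_change:
  fixes h G :: "real \<Rightarrow> real"
  assumes h: "continuous_on {c..} h" "\<And>t. c \<le> t \<Longrightarrow> 0 < h t"
    and G: "\<And>t. c \<le> t \<Longrightarrow> (G has_real_derivative G' t) (at t within {c..})"
      "\<And>t. c \<le> t \<Longrightarrow> h t \<le> G' t" "\<And>t. c \<le> t \<Longrightarrow> G t \<le> C"
  shows "\<exists>S T w. 0 < w \<and> S c = 0 \<and> T 0 = c \<and>
    (\<forall>s\<in>{0..<w}. c \<le> T s \<and> (T has_real_derivative 1 / h (T s)) (at s within {0..<w})) \<and>
    filterlim T at_top (at_left w) \<and>
    (\<forall>t\<ge>c. (S has_real_derivative h t) (at t within {c..}) \<and> S t \<in> {0..<w} \<and> T (S t) = t)"
proof -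
  \<comment> \<open>Extending h constantly to the left of c makes c an interior point, so that the
    rule for inverse functions also applies at S c = 0.\<close>
  define g where "g = (\<lambda>t. h (max c t))"
  have gcont: "continuous_on {c-1..} g" unfolding g_def
    by (rule continuous_on_compose2[OF h(1)]) (auto intro!: continuous_intros)
  have gpos: "0 < g t" for t by (simp add: g_def h(2))
  define S where "S = (\<lambda>t. integral {c-1..t} g - integral {c-1..c} g)"
  have S': "(S has_real_derivative g t) (at t)" if "c - 1 < t" for t
  proof -
    have "(S has_real_derivative g t) (at t within {c-1..})"
      unfolding S_def using has_real_derivative_integral_atLeast[OF gcont, of t] that
      by (auto intro!: derivative_eq_intros)
    also have "at t within {c-1..} = at t"
      by (rule at_within_interior) (use that in \<open>simp add: interior_real_atLeast\<close>)
    finally show ?thesis .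
  qed
  have Sc: "S c = 0" by (simp add: S_def)
  have mono: "S x < S y" if "c - 1 < x" "x < y" for x y
  proof (rule DERIV_pos_imp_increasing[OF that(2)])
    fix z assume "x \<le> z" "z \<le> y"
    then have "c - 1 < z" using that by simp
    then show "\<exists>d. (S has_real_derivative d) (at z) \<and> 0 < d" using S' gpos by blast
  qed
  have Scont: "isCont S t" if "c - 1 < t" for t using S'[OF that] by (rule DERIV_isCont)
  have le: "S t \<le> C - G c" if "c \<le> t" for t
  proof (cases "c = t")
    case True then show ?thesis using G(3)[of c] Sc by simp
  next
    case False
    with that have "c < t" by simp
    have "((\<lambda>t. S t - G t) has_real_derivative g x - G' x) (at x within {c..})" if "x \<in> {c..t}" for x
      using that by (auto intro!: derivative_intros G(1) has_field_derivative_at_within[OF S'])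
    from mvt_within[OF \<open>c < t\<close> _ this]
    obtain z where "c < z" "z < t" "(S t - G t) - (S c - G c) = (g z - G' z) * (t - c)"
      by auto
    moreover have "g z \<le> G' z" using G(2)[of z] \<open>c < z\<close> by (simp add: g_def max_def)
    ultimately have "(S t - G t) - (S c - G c) \<le> 0" using \<open>c < t\<close> by (simp add: mult_nonpos_nonneg)
    with Sc G(3)[OF that] show ?thesis by simp
  qed
  define w where "w = (SUP t\<in>{c..}. S t)"
  have bdd: "bdd_above (S ` {c..})" using le by (auto intro!: bdd_aboveI)
  have less_w: "S t < w" if "c - 1 < t" for t
  proof -
    have "S t < S (max t c + 1)" using that by (intro mono) auto
    also have "\<dots> \<le> w" unfolding w_def by (rule cSUP_upper[OF _ bdd]) auto
    finally show ?thesis .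
  qed
  define T where "T = inv_into {c-1<..} S"
  have inj: "inj_on S {c-1<..}"
    by (intro strict_mono_on_imp_inj_on) (auto simp: strict_mono_on_def mono)
  have TS: "T (S t) = t" if "c - 1 < t" for t
    unfolding T_def by (rule inv_into_f_f[OF inj]) (use that in auto)
  have surj: "\<exists>t\<ge>m. S t = s" if "c - 1 < m" "S m \<le> s" "s < w" for m s
  proof -
    obtain t' where t': "c \<le> t'" "s < S t'"
      using \<open>s < w\<close> less_cSUP_iff[OF _ bdd, of s] unfolding w_def by auto
    then have "m \<le> t'" using mono[of t' m] that by force
    then have "\<exists>t\<ge>m. t \<le> t' \<and> S t = s"
      using that t' by (intro IVT') (auto intro!: continuous_at_imp_continuous_on Scont)
    then show ?thesis by blast
  qed
  have T': "(T has_real_derivative 1 / h t) (at (S t))" if t: "c \<le> t" for t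
  proof -
    have "(T has_real_derivative inverse (g t)) (at (S t))"
    proof (rule DERIV_inverse_function[where f=S and a="S (c - 1/2)" and b=w])
      show "(S has_real_derivative g t) (at (T (S t)))" using t TS S' by simp
      show "g t \<noteq> 0" using gpos[of t] by simp
      show "S (c - 1/2) < S t" using t by (intro mono) auto
      show "S t < w" using less_w t by simp
      show "S (T y) = y" if y: "S (c - 1/2) < y" "y < w" for y
      proof -
        obtain u where "u \<ge> c - 1/2" "S u = y" using surj[of "c - 1/2" y] y by auto
        then show ?thesis using TS[of u] by auto
      qed
      show "isCont T (S t)"
        by (rule isCont_inverse_function2[where a="c - 1/2" and b="t + 1"])
          (use t TS Scont in auto)
    qed
    then show ?thesis using t by (simp add: g_def max_def inverse_eq_divide)
  qed
  have inv: "\<exists>t\<ge>c. S t = s" if "s \<in> {0..<w}" for s using surj[of c s] that Sc by auto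
  show ?thesis
  proof (rule exI[of _ S], rule exI[of _ T], rule exI[of _ w], intro conjI ballI allI impI)
    show "0 < w" using less_w[of c] Sc by simp
    show "S c = 0" by fact
    show "T 0 = c" using TS[of c] Sc by simp
    show "c \<le> T s" if "s \<in> {0..<w}" for s using inv[OF that] TS by fastforce
    show "(T has_real_derivative 1 / h (T s)) (at s within {0..<w})" if s: "s \<in> {0..<w}" for s
    proof -
      obtain t where "t \<ge> c" "S t = s" using inv[OF s] by auto
      then show ?thesis using T'[of t] TS[of t] has_field_derivative_at_within by auto
    qed
    show "(S has_real_derivative h t) (at t within {c..})" if "c \<le> t" for t
      using S'[of t] that has_field_derivative_at_within by (auto simp: g_def max_def)
    show "S t \<in> {0..<w}" "T (S t) = t" if "c \<le> t" for t
      using mono[of c t] less_w[of t] TS[of t] Sc that by (cases "c = t"; auto)+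
    show "filterlim T at_top (at_left w)"
      unfolding filterlim_at_top
    proof
      fix Z
      define m where "m = max Z c"
      have m: "c \<le> m" "Z \<le> m" "c - 1 < m" by (auto simp: m_def)
      have "\<forall>\<^sub>F s in at_left w. S m < s \<and> s < w"
        unfolding eventually_at_left_field using less_w[of m]
        by (intro exI[of _ "S m"]) (use m in auto)
      then show "\<forall>\<^sub>F s in at_left w. Z \<le> T s"
      proof eventually_elim
        case (elim s)
        then obtain u where "u \<ge> m" "S u = s" using surj[of m s] m by auto
        then show ?case using TS[of u] m by auto
      qed
    qed
  qed
qed

section \<open>The integral in the definition of sigma\<close>

text \<open>\<open>kappa M a t r = r\<^sup>2 * cubic M (1 / (a t)\<^sup>2) (1 / r)\<close>: in the variable \<open>1 / r\<close> the improper
  integral in \<^const>\<open>sigma\<close> becomes a proper one with a smooth integrand, to which Leibniz'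
  rule applies.\<close>

definition cubic :: "real \<Rightarrow> real \<Rightarrow> real \<Rightarrow> real" where
  "cubic M b x = b + x\<^sup>2 - 2 * M * x ^ 3"

definition Phi :: "real \<Rightarrow> real \<Rightarrow> real \<Rightarrow> real" where
  "Phi M b X = integral {0..X} (\<lambda>x. cubic M b x powr (-3/2))"

lemma powr_neg_three_halves: "0 < y \<Longrightarrow> y powr (-3/2) = 1 / (y * sqrt y)" for y :: real
proof -
  assume y: "0 < y"
  have "y powr (-3/2) = y powr - (1 + 1/2)" by simp
  also have "\<dots> = 1 / (y * sqrt y)"
    unfolding powr_minus powr_add using y by (simp add: powr_half_sqrt inverse_eq_divide)
  finally show ?thesis .
qed

text \<open>Where 2 M x <= 1 the term x^2 (1 - 2 M x) is nonnegative and b alone gives positivity.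
  Beyond that, x^2 (2 M x - 1) increases with x, so X is the worst case. For X = 1 / r this says
  that \<open>kappa\<close> stays positive outward from r.\<close>

lemma cubic_pos_below:
  assumes "0 < M" "0 < b" "0 < cubic M b X" "0 \<le> x" "x \<le> X"
  shows "0 < cubic M b x"
proof (cases "2 * M * x \<le> 1")
  case True
  then have "0 \<le> x\<^sup>2 * (1 - 2 * M * x)" by simp
  then show ?thesis using assms(2) by (simp add: cubic_def algebra_simps power2_eq_square power3_eq_cube)
next
  case False
  have "x\<^sup>2 * (2 * M * x - 1) \<le> X\<^sup>2 * (2 * M * X - 1)"
    using assms False by (intro mult_mono power_mono) auto
  then show ?thesis using assms(3) by (simp add: cubic_def algebra_simps power2_eq_square power3_eq_cube)
qed

lemma cubic_mono: "b \<le> b' \<Longrightarrow> cubic M b x \<le> cubic M b' x"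
  by (simp add: cubic_def)

lemma continuous_on_cubic [continuous_intros]:
  assumes "continuous_on S f" "continuous_on S g"
  shows "continuous_on S (\<lambda>z. cubic M (f z) (g z))"
  unfolding cubic_def by (intro continuous_intros assms)

lemma continuous_on_cubic_powr:
  assumes "0 < M" "0 < b" "0 < cubic M b X"
  shows "continuous_on {0..X} (\<lambda>x. cubic M b x powr e)"
  by (intro continuous_intros) (use cubic_pos_below[OF assms] in force)

lemma has_real_derivative_Phi_upper:
  assumes "0 < M" "0 < b" "0 < X" "0 < cubic M b X"
  shows "(Phi M b has_real_derivative cubic M b X powr (-3/2)) (at X)"
proof -
  have "open {x. 0 < cubic M b x}"
    by (intro open_Collect_less continuous_intros)
  \<comment> \<open>The cubic stays positive a little beyond X; integrating up to Y > X makes X an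
    interior point and the derivative two-sided.\<close>
  then obtain e where e: "e > 0" "ball X e \<subseteq> {x. 0 < cubic M b x}"
    using assms(4) by (auto elim: openE)
  define Y where "Y = X + e/2"
  have Y: "X < Y" "0 < cubic M b Y" using e by (auto simp: Y_def subset_eq dist_real_def)
  have "(Phi M b has_real_derivative cubic M b X powr (-3/2)) (at X within {0..Y})"
    unfolding Phi_def
    by (rule integral_has_real_derivative[OF continuous_on_cubic_powr]) (use assms Y in auto)
  also have "at X within {0..Y} = at X" by (rule at_within_Icc_at) (use assms Y in auto)
  finally show ?thesis .
qed

lemma has_real_derivative_Phi_parameter:
  assumes "0 < M" "0 < b" "0 < X" "0 < cubic M b X"
  shows "((\<lambda>b. Phi M b X) has_real_derivative integral {0..X} (\<lambda>x. -3/2 * cubic M b x powr (-5/2))) (at b)"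
proof -
  \<comment> \<open>\<open>cubic\<close> has slope 1 in b, so lowering b by less than
    \<open>cubic M b X\<close> keeps it positive at X; the minimum with b keeps the parameter itself
    positive.\<close>
  define c where "c = b - min b (cubic M b X) / 2"
  have c: "0 < c" "c < b" using assms by (auto simp: c_def min_def)
  have pos: "0 < cubic M b' x" if "c < b'" "0 \<le> x" "x \<le> X" for b' x
  proof (rule cubic_pos_below[OF \<open>0 < M\<close> _ _ that(2,3)])
    show "0 < b'" using c that by simp
    have "0 < cubic M c X" using assms by (auto simp: c_def cubic_def min_def field_simps)
    then show "0 < cubic M b' X" using cubic_mono[of c b' M X] that by simp
  qed
  have "((\<lambda>b. integral (cbox 0 X) (\<lambda>x. cubic M b x powr (-3/2))) has_field_derivative
      integral (cbox 0 X) ((\<lambda>b x. -3/2 * cubic M b x powr (-5/2)) b)) (at b within {c<..})"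
  proof (rule leibniz_rule_field_derivative)
    fix b' x assume "b' \<in> {c<..}" "x \<in> cbox 0 X"
    then have p: "0 < cubic M b' x" using pos by simp
    have "((\<lambda>b. cubic M b x) has_real_derivative 1) (at b' within {c<..})"
      unfolding cubic_def by (auto intro!: derivative_eq_intros)
    from DERIV_fun_powr[OF has_field_derivative_at_within]
    show "((\<lambda>b. cubic M b x powr (-3/2)) has_field_derivative -3/2 * cubic M b' x powr (-5/2))
        (at b' within {c<..})"
      unfolding cubic_def using p
      by (auto intro!: derivative_eq_intros simp: cubic_def)
  next
    fix b' assume "b' \<in> {c<..}"
    then show "(\<lambda>x. cubic M b' x powr (-3/2)) integrable_on cbox 0 X"
      unfolding cbox_interval using c assms pos[of b' X]
      by (intro integrable_continuous_real continuous_on_cubic_powr) auto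
  next
    show "continuous_on ({c<..} \<times> cbox 0 X) (\<lambda>(b, x). -3/2 * cubic M b x powr (-5/2))"
      unfolding case_prod_beta
      by (intro continuous_intros) (use pos in force)+
  qed (use c in auto)
  also have "at b within {c<..} = at b"
    by (rule at_within_open) (use c in auto)
  finally show ?thesis by (simp add: Phi_def)
qed

text \<open>The criterion by partial derivatives asks for joint continuity of only one of them. Here
  that is the X-partial, which is the integrand at the endpoint; the b-partial has to exist at the
  point only, and \<open>D\<close> can stay without a formula.\<close>

lemma Phi_has_derivative:
  assumes "0 < M" "0 < b" "0 < X" "0 < cubic M b X"
  obtains D where "((\<lambda>(b, X). Phi M b X) has_derivative
      (\<lambda>(db, dX). D * db + cubic M b X powr (-3/2) * dX)) (at (b, X))"
proof -
  let ?U = "{p::real \<times> real. 0 < fst p \<and> 0 < snd p \<and> 0 < cubic M (fst p) (snd p)}"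
  have "open ?U"
    by (intro open_Collect_conj open_Collect_less continuous_intros)
  moreover have "(b, X) \<in> ?U" using assms by simp
  ultimately obtain A B where "open A" "open B" "(b, X) \<in> A \<times> B" "A \<times> B \<subseteq> ?U"
    by (rule open_prod_elim)
  then have AB: "open A" "open B" "b \<in> A" "X \<in> B" "A \<times> B \<subseteq> ?U" by auto
  \<comment> \<open>The criterion asks for a convex set of values of X, hence a ball.\<close>
  obtain e where e: "0 < e" "ball X e \<subseteq> B" using AB by (auto elim: openE)
  define B' where "B' = ball X e"
  have B': "open B'" "convex B'" "X \<in> B'" "A \<times> B' \<subseteq> ?U" using AB e by (auto simp: B'_def)
  let ?fy = "\<lambda>b X. blinfun_mult_right (cubic M b X powr (-3/2))"
  let ?D = "integral {0..X} (\<lambda>x. -3/2 * cubic M b x powr (-5/2))"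
  have "((\<lambda>(b, X). Phi M b X) has_derivative (\<lambda>(db, dX). ?D * db + ?fy b X dX)) (at (b, X) within A \<times> B')"
  proof (rule has_derivative_partialsI)
    show "((\<lambda>b. Phi M b X) has_derivative (\<lambda>db. ?D * db)) (at b within A)"
      using has_real_derivative_Phi_parameter[OF assms, unfolded has_field_derivative_def]
      by (rule has_derivative_at_withinI)
    show "(Phi M b' has_derivative blinfun_apply (?fy b' X')) (at X' within B')"
      if "b' \<in> A" "X' \<in> B'" for b' X'
    proof -
      have "(b', X') \<in> ?U" using B'(4) that by blast
      then have "(Phi M b' has_real_derivative cubic M b' X' powr (-3/2)) (at X')"
        using assms by (intro has_real_derivative_Phi_upper) auto
      then show ?thesis
        by (simp add: has_field_derivative_def has_derivative_at_withinI)
    qed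
    have "continuous_on (A \<times> B') (\<lambda>p. blinfun_mult_right (cubic M (fst p) (snd p) powr (-3/2)))"
      by (intro bounded_linear.continuous_on[OF bounded_linear_blinfun_mult_right] continuous_intros)
        (use B'(4) in fastforce)
    then have "continuous (at (b, X) within A \<times> B')
        (\<lambda>p. blinfun_mult_right (cubic M (fst p) (snd p) powr (-3/2)))"
      using AB B' by (simp add: continuous_on_eq_continuous_within)
    then show "continuous (at (b, X) within A \<times> B') (\<lambda>(b, X). ?fy b X)"
      unfolding case_prod_beta .
  qed (use AB B' in auto)
  also have "at (b, X) within A \<times> B' = at (b, X)"
    by (rule at_within_open) (use AB B' in \<open>auto intro: open_Times\<close>)
  finally show thesis by (intro that[of ?D]) simp
qed

text \<open>Dropping - 2 M x^3 enlarges the cubic and shrinks its power -3/2; what remains has the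
  antiderivative x / (b sqrt(b + x^2)). The factor 1 / b will cancel the b in \<open>J\<close>,
  which leaves a bound that survives b tending to 0.\<close>

lemma Phi_ge:
  assumes "0 < M" "0 < b" "0 < X" "0 < cubic M b X"
  shows "X / (b * sqrt (b + X\<^sup>2)) \<le> Phi M b X"
proof -
  have "((\<lambda>x. (b + x\<^sup>2) powr (-3/2)) has_integral
      X / (b * sqrt (b + X\<^sup>2)) - 0 / (b * sqrt (b + 0\<^sup>2))) {0..X}"
  proof (rule fundamental_theorem_of_calculus)
    fix x
    define s where "s = sqrt (b + x\<^sup>2)"
    have pos: "0 < b + x\<^sup>2" using assms by (simp add: add_pos_nonneg)
    then have s: "0 < s" "s\<^sup>2 = b + x\<^sup>2" "sqrt (b + x * x) = s" by (auto simp: s_def power2_eq_square)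
    have "((\<lambda>x. x / (b * sqrt (b + x\<^sup>2))) has_real_derivative
        (1 * (b * s) - x * (b * (2 * x / (2 * s)))) / ((b * s) * (b * s))) (at x within {0..X})"
      using pos s(1) \<open>0 < b\<close> unfolding s_def
      by (auto intro!: derivative_eq_intros simp: field_simps)
    also have "(1 * (b * s) - x * (b * (2 * x / (2 * s)))) / ((b * s) * (b * s)) = b * (s\<^sup>2 - x\<^sup>2) / (b\<^sup>2 * (s\<^sup>2 * s))"
      using s(1) \<open>0 < b\<close> by (simp add: field_simps power2_eq_square)
    also have "s\<^sup>2 - x\<^sup>2 = b" by (simp add: s(2))
    also have "b * b / (b\<^sup>2 * (s\<^sup>2 * s)) = 1 / (s\<^sup>2 * s)" using \<open>0 < b\<close> by (simp add: power2_eq_square)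
    also have "\<dots> = (b + x\<^sup>2) powr (-3/2)"
      unfolding s(2) using powr_neg_three_halves[OF pos] by (simp add: s_def)
    finally show "((\<lambda>x. x / (b * sqrt (b + x\<^sup>2))) has_vector_derivative (b + x\<^sup>2) powr (-3/2)) (at x within {0..X})"
      by (simp add: has_real_derivative_iff_has_vector_derivative)
  qed (use assms in auto)
  then have *: "((\<lambda>x. (b + x\<^sup>2) powr (-3/2)) has_integral X / (b * sqrt (b + X\<^sup>2))) {0..X}" by simp
  show ?thesis unfolding Phi_def
  proof (rule has_integral_le[OF * integrable_integral])
    show "(\<lambda>x. cubic M b x powr (-3/2)) integrable_on {0..X}"
      using assms by (intro integrable_continuous_real continuous_on_cubic_powr) auto
    fix x assume x: "x \<in> {0..X}"
    then have "0 < cubic M b x" using cubic_pos_below assms by auto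
    moreover have "cubic M b x \<le> b + x\<^sup>2" using x assms by (simp add: cubic_def)
    ultimately show "(b + x\<^sup>2) powr (-3/2) \<le> cubic M b x powr (-3/2)"
      by (intro powr_mono2') auto
  qed
qed

text \<open>By the chain rule - Phi M b (1 / \<rho>) is an antiderivative, and its limit at infinity
  is - Phi M b 0 = 0.\<close>

lemma has_integral_Phi:
  assumes "0 < M" "0 < b" "0 < r" "0 < cubic M b (1 / r)"
  shows "((\<lambda>\<rho>. \<rho> * (1 - 2 * M / \<rho> + \<rho>\<^sup>2 * b) powr (-3/2)) has_integral Phi M b (1 / r)) {r..}"
proof (rule has_integral_to_inf)
  have pos: "0 < cubic M b (1 / \<rho>)" if "r \<le> \<rho>" for \<rho>
    using that assms by (intro cubic_pos_below[OF assms(1,2,4)]) (auto simp: frac_le)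
  have cub: "1 - 2 * M / \<rho> + \<rho>\<^sup>2 * b = \<rho>\<^sup>2 * cubic M b (1 / \<rho>)" if "r \<le> \<rho>" for \<rho>
    using that assms by (simp add: cubic_def field_simps power2_eq_square power3_eq_cube)
  have int: "((\<lambda>\<rho>. \<rho> * (1 - 2 * M / \<rho> + \<rho>\<^sup>2 * b) powr (-3/2)) has_integral (- Phi M b (1 / y) - - Phi M b (1 / r))) {r..y}"
    if "r \<le> y" for y
  proof (rule fundamental_theorem_of_calculus[OF that])
    fix \<rho> assume "\<rho> \<in> {r..y}"
    then have \<rho>: "r \<le> \<rho>" "0 < \<rho>" using assms by auto
    let ?c = "cubic M b (1 / \<rho>)"
    have "(Phi M b has_real_derivative ?c powr (-3/2)) (at (1 / \<rho>))"
      using assms \<rho> pos by (intro has_real_derivative_Phi_upper) auto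
    moreover have "((\<lambda>\<rho>. 1 / \<rho>) has_real_derivative - 1 / \<rho>\<^sup>2) (at \<rho> within {r..y})"
      using \<rho> by (auto intro!: derivative_eq_intros simp: power2_eq_square)
    ultimately have "((\<lambda>\<rho>. Phi M b (1 / \<rho>)) has_real_derivative ?c powr (-3/2) * (- 1 / \<rho>\<^sup>2)) (at \<rho> within {r..y})"
      by (rule DERIV_chain2)
    then have "((\<lambda>\<rho>. - Phi M b (1 / \<rho>)) has_real_derivative - (?c powr (-3/2) * (- 1 / \<rho>\<^sup>2))) (at \<rho> within {r..y})"
      by (rule DERIV_minus)
    also have "- (?c powr (-3/2) * (- 1 / \<rho>\<^sup>2)) = \<rho> * (\<rho>\<^sup>2 * ?c) powr (-3/2)"
    proof -
      have "0 < ?c" "0 < \<rho>\<^sup>2 * ?c" using \<rho> pos[OF \<rho>(1)] by auto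
      then show ?thesis
        unfolding powr_neg_three_halves[OF \<open>0 < ?c\<close>] powr_neg_three_halves[OF \<open>0 < \<rho>\<^sup>2 * ?c\<close>]
        using \<rho>(2) by (simp add: real_sqrt_mult field_simps power2_eq_square)
    qed
    finally show "((\<lambda>\<rho>. - Phi M b (1 / \<rho>)) has_vector_derivative \<rho> * (1 - 2 * M / \<rho> + \<rho>\<^sup>2 * b) powr (-3/2)) (at \<rho> within {r..y})"
      using cub[OF \<rho>(1)] by (simp add: has_real_derivative_iff_has_vector_derivative)
  qed
  show "(\<lambda>\<rho>. \<rho> * (1 - 2 * M / \<rho> + \<rho>\<^sup>2 * b) powr (-3/2)) integrable_on {r..y}" for y
  proof (cases "r \<le> y")
    case True then show ?thesis using int by blast
  qed (auto intro: integrable_on_empty)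
  have "continuous_on {0..1/r} (Phi M b)"
    unfolding Phi_def using assms
    by (intro indefinite_integral_continuous_1 integrable_continuous_real continuous_on_cubic_powr) auto
  then have "((\<lambda>y. Phi M b (1 / y)) \<longlongrightarrow> Phi M b 0) at_top"
  proof (rule continuous_on_tendsto_compose)
    show "((\<lambda>y. 1 / y) \<longlongrightarrow> 0) (at_top :: real filter)"
      by (rule tendsto_divide_0[OF tendsto_const filterlim_at_top_imp_at_infinity[OF filterlim_ident]])
    show "\<forall>\<^sub>F y in at_top. 1 / y \<in> {0..1/r}"
      using eventually_ge_at_top[of r] by eventually_elim (use assms in \<open>auto simp: frac_le\<close>)
  qed (use assms in auto)
  then have "((\<lambda>y. - Phi M b (1 / y) - - Phi M b (1 / r)) \<longlongrightarrow> Phi M b (1 / r)) at_top"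
    by (auto intro!: tendsto_eq_intros simp: Phi_def)
  then show "((\<lambda>y. integral {r..y} (\<lambda>\<rho>. \<rho> * (1 - 2 * M / \<rho> + \<rho>\<^sup>2 * b) powr (-3/2))) \<longlongrightarrow> Phi M b (1 / r)) at_top"
    by (rule Lim_transform_eventually)
      (rule eventually_at_top_linorderI[of r], rule integral_unique[OF int, symmetric])
qed (use assms in auto)

section \<open>The equation for ingoing null rays\<close>

lemma has_derivative_compose_fst:
  fixes g :: "real \<Rightarrow> real" and p :: "real \<times> 'b::real_normed_vector"
  assumes "(g has_real_derivative g') (at (fst p))"
  shows "((\<lambda>p. g (fst p)) has_derivative (\<lambda>d. g' * fst d)) (at p)"
  by (rule has_derivative_compose[OF has_derivative_fst[OF has_derivative_ident]])
    (use assms in \<open>simp add: has_field_derivative_def\<close>)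

lemma has_derivative_compose_snd:
  fixes g :: "real \<Rightarrow> real" and p :: "'b::real_normed_vector \<times> real"
  assumes "(g has_real_derivative g') (at (snd p))"
  shows "((\<lambda>p. g (snd p)) has_derivative (\<lambda>d. g' * snd d)) (at p)"
  by (rule has_derivative_compose[OF has_derivative_snd[OF has_derivative_ident]])
    (use assms in \<open>simp add: has_field_derivative_def\<close>)

text \<open>\<open>null_energy\<close> is the condition mu + P > 0 written out, since 4 pi (mu + P)
  = - (H' + 1 / a^2).\<close>

locale mcvittie =
  fixes M :: real and a :: "real \<Rightarrow> real"
  assumes M_pos: "0 < M"
    and a_pos: "0 < t \<Longrightarrow> 0 < a t"
    and hubble_pos: "0 < t \<Longrightarrow> 0 < hubble a t"
    and differentiable_a: "0 < t \<Longrightarrow> a differentiable (at t)"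
    and differentiable_deriv_a: "0 < t \<Longrightarrow> deriv a differentiable (at t)"
    and continuous_deriv2_a: "continuous_on {0<..} (deriv (deriv a))"
    and null_energy: "0 < t \<Longrightarrow> deriv (hubble a) t + 1 / (a t)\<^sup>2 < 0"
begin

abbreviation H :: "real \<Rightarrow> real" where "H \<equiv> hubble a"
abbreviation H' :: "real \<Rightarrow> real" where "H' \<equiv> deriv (hubble a)"
abbreviation \<kappa> :: "real \<Rightarrow> real \<Rightarrow> real" where "\<kappa> \<equiv> kappa M a"
abbreviation \<Omega> :: "(real \<times> real) set" where "\<Omega> \<equiv> Omega M a"

definition b :: "real \<Rightarrow> real" where "b t = 1 / (a t)\<^sup>2"
text \<open>By the Friedmann equation this is (8 pi mu + Lambda) / 3.\<close>

definition N :: "real \<Rightarrow> real" where "N t = (H t)\<^sup>2 - b t"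
text \<open>The factor of \<open>sigma\<close> that remains after splitting off H
  sqrt(kappa).\<close>

definition J :: "real \<Rightarrow> real \<Rightarrow> real" where "J t r = b t * Phi M (b t) (1 / r)"
text \<open>This is dr/dt along ingoing rays, with the division by H cancelled against the H in
  \<open>sigma\<close>.\<close>

definition speed :: "real \<Rightarrow> real \<Rightarrow> real" where
  "speed t r = J t r * (r * H t * sqrt (\<kappa> t r) - \<kappa> t r)"

section \<open>Calculus of the background functions and description of the domain\<close>

lemma b_pos: "0 < t \<Longrightarrow> 0 < b t"
  using a_pos[of t] by (simp add: b_def)

lemma NEC: "0 < t \<Longrightarrow> H' t + b t < 0"
  using null_energy by (simp add: b_def)

lemma kappa_eq: "\<kappa> t r = 1 - 2 * M / r + r\<^sup>2 * b t"
  by (simp add: kappa_def b_def)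

lemma DERIV_a: "0 < t \<Longrightarrow> (a has_real_derivative H t * a t) (at t)"
  using a_pos[of t] differentiable_a[of t]
  by (simp add: hubble_def DERIV_deriv_iff_real_differentiable)

lemma DERIV_H: "0 < t \<Longrightarrow> (H has_real_derivative H' t) (at t)"
  and deriv_H: "0 < t \<Longrightarrow> H' t = deriv (deriv a) t / a t - (H t)\<^sup>2"
proof -
  assume t: "0 < t"
  have "((\<lambda>t. deriv a t / a t) has_real_derivative
      (deriv (deriv a) t * a t - deriv a t * deriv a t) / (a t * a t)) (at t)"
    using t differentiable_a[OF t] differentiable_deriv_a[OF t] a_pos[OF t]
    by (intro DERIV_divide) (simp_all add: DERIV_deriv_iff_real_differentiable)
  then have *: "(H has_real_derivative
      (deriv (deriv a) t * a t - deriv a t * deriv a t) / (a t * a t)) (at t)"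
    by (simp add: hubble_def[abs_def])
  show "(H has_real_derivative H' t) (at t)" using DERIV_imp_deriv[OF *] * by simp
  show "H' t = deriv (deriv a) t / a t - (H t)\<^sup>2"
    using DERIV_imp_deriv[OF *] a_pos[OF t] by (simp add: hubble_def field_simps power2_eq_square)
qed

lemma DERIV_b: "0 < t \<Longrightarrow> (b has_real_derivative - 2 * H t * b t) (at t)"
  unfolding b_def[abs_def] using a_pos[of t]
  by (auto intro!: derivative_eq_intros DERIV_a simp: field_simps power2_eq_square power4_eq_xxxx)

lemma DERIV_N: "0 < t \<Longrightarrow> (N has_real_derivative 2 * H t * (H' t + b t)) (at t)"
  unfolding N_def[abs_def]
  by (auto intro!: derivative_eq_intros DERIV_H DERIV_b simp: algebra_simps)

lemma continuous_on_H: "continuous_on {0<..} H"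
  and continuous_on_b: "continuous_on {0<..} b"
  and continuous_on_N: "continuous_on {0<..} N"
  by (auto intro!: continuous_at_imp_continuous_on DERIV_isCont DERIV_H DERIV_b DERIV_N)

lemma continuous_on_deriv_H: "continuous_on {0<..} H'"
proof -
  have "continuous_on {0<..} a"
    by (auto intro!: continuous_at_imp_continuous_on DERIV_isCont DERIV_a)
  then have "continuous_on {0<..} (\<lambda>t. deriv (deriv a) t / a t - (H t)\<^sup>2)"
    by (intro continuous_intros continuous_deriv2_a continuous_on_H) (auto dest: a_pos)
  then show ?thesis by (rule continuous_on_eq) (simp add: deriv_H)
qed

lemma kappa_less:
  assumes "0 < t" "0 < r" "r < r'"
  shows "\<kappa> t r < \<kappa> t r'"
proof -
  have "2 * M / r' < 2 * M / r" using assms M_pos by (simp add: frac_less2)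
  moreover have "r\<^sup>2 * b t \<le> r'\<^sup>2 * b t"
    using assms b_pos[of t] by (intro mult_right_mono power_mono) auto
  ultimately show ?thesis by (simp add: kappa_eq)
qed

text \<open>\<open>kappa\<close> is strictly increasing in r and changes sign between a small radius
  and 2 M. So the \<open>THE\<close> in \<open>r1\<close> denotes an actual zero, and r > r1 amounts
  to kappa > 0.\<close>

lemma Omega_iff: "(t, r) \<in> \<Omega> \<longleftrightarrow> 0 < t \<and> 0 < r \<and> 0 < \<kappa> t r"
proof (cases "0 < t")
  case t: True
  \<comment> \<open>Chosen to give 2 M / \<epsilon> >= 2 and \<epsilon>^2 b <= 1/2, hence kappa <=
    -1/2.\<close>
  define \<epsilon> where "\<epsilon> = min M (1 / (2 * b t * M))"
  have \<epsilon>: "0 < \<epsilon>" "\<epsilon> \<le> M" using M_pos b_pos[OF t] by (auto simp: \<epsilon>_def)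
  have "\<epsilon>\<^sup>2 * b t \<le> \<epsilon> * M * b t" using \<epsilon> b_pos[OF t] by (simp add: power2_eq_square)
  also have "\<dots> \<le> 1 / (2 * b t * M) * M * b t"
    using M_pos b_pos[OF t] by (intro mult_right_mono) (auto simp: \<epsilon>_def)
  also have "\<dots> \<le> 1/2" using M_pos b_pos[OF t] by simp
  finally have "\<kappa> t \<epsilon> \<le> 1 - 2 * M / \<epsilon> + 1/2" by (simp add: kappa_eq)
  moreover have "2 * M / \<epsilon> \<ge> 2" using \<epsilon> M_pos by (simp add: field_simps)
  ultimately have neg: "\<kappa> t \<epsilon> \<le> 0" by simp
  have pos: "0 < \<kappa> t (2 * M)" using M_pos b_pos[OF t] by (simp add: kappa_eq)
  have "\<exists>r\<ge>\<epsilon>. r \<le> 2 * M \<and> \<kappa> t r = 0"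
    by (rule IVT') (use neg pos \<epsilon> M_pos in \<open>auto simp: kappa_eq intro!: continuous_intros\<close>)
  then obtain z where "\<epsilon> \<le> z" "\<kappa> t z = 0" by blast
  with \<epsilon> have z: "0 < z" "\<kappa> t z = 0" by auto
  have "r1 M a t = z" unfolding r1_def
  proof (rule the_equality)
    fix r assume "0 < r \<and> \<kappa> t r = 0"
    then show "r = z" using kappa_less[OF t, of r z] kappa_less[OF t, of z r] z
      by (metis less_irrefl linorder_neqE)
  qed (use z in simp)
  then show ?thesis
    using t z kappa_less[OF t, of r z] kappa_less[OF t, of z r]
    by (auto simp: Omega_def) (metis linorder_neqE order_less_asym)
qed (simp add: Omega_def)

lemma cubic_inverse: "0 < r \<Longrightarrow> cubic M (b t) (1 / r) = \<kappa> t r / r\<^sup>2"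
  by (simp add: cubic_def kappa_eq field_simps power2_eq_square power3_eq_cube)

lemma Omega_D:
  assumes "(t, r) \<in> \<Omega>"
  shows "0 < t" "0 < r" "0 < \<kappa> t r" "0 < b t" "0 < H t" "0 < cubic M (b t) (1 / r)"
  using assms b_pos[of t] hubble_pos[of t] cubic_inverse[of r t] by (auto simp: Omega_iff)

lemma J_ge:
  assumes "(t, r) \<in> \<Omega>"
  shows "1 / sqrt (1 + b t * r\<^sup>2) \<le> J t r"
proof -
  note \<Omega> = Omega_D[OF assms]
  have "1 / r / (b t * sqrt (b t + (1 / r)\<^sup>2)) \<le> Phi M (b t) (1 / r)"
    by (rule Phi_ge) (use \<Omega> M_pos in auto)
  then have "b t * (1 / r / (b t * sqrt (b t + (1 / r)\<^sup>2))) \<le> J t r"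
    unfolding J_def using \<Omega> by (intro mult_left_mono) auto
  also have "b t * (1 / r / (b t * sqrt (b t + (1 / r)\<^sup>2))) = 1 / (sqrt (r\<^sup>2) * sqrt (b t + (1 / r)\<^sup>2))"
    using \<Omega> by simp
  also have "\<dots> = 1 / sqrt (1 + b t * r\<^sup>2)"
    unfolding real_sqrt_mult[symmetric] using \<Omega> by (simp add: field_simps)
  finally show ?thesis .
qed

lemma J_pos: "(t, r) \<in> \<Omega> \<Longrightarrow> 0 < J t r"
proof -
  assume *: "(t, r) \<in> \<Omega>"
  have "0 < 1 / sqrt (1 + b t * r\<^sup>2)" using Omega_D[OF *] by (simp add: add_pos_pos)
  with J_ge[OF *] show ?thesis by linarith
qed

lemma sigma_eq:
  assumes "(t, r) \<in> \<Omega>"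
  shows "sigma M a t r = H t * sqrt (\<kappa> t r) * J t r"
proof -
  note \<Omega> = Omega_D[OF assms]
  have "((\<lambda>\<rho>. \<rho> * \<kappa> t \<rho> powr (-3/2)) has_integral Phi M (b t) (1 / r)) {r..}"
    unfolding kappa_eq by (rule has_integral_Phi) (use \<Omega> M_pos in auto)
  then show ?thesis
    unfolding sigma_def by (simp add: integral_unique J_def b_def)
qed

lemma speed_eq:
  assumes "(t, r) \<in> \<Omega>"
  shows "sigma M a t r * (r - sqrt (\<kappa> t r) / H t) = speed t r"
  using Omega_D[OF assms] by (simp add: sigma_eq[OF assms] speed_def field_simps)

text \<open>A bare \<open>deriv\<close> is enough: \<open>J_t\<close> cancels from the radial
  geodesic equation and enters the time component only through \<open>speed_t\<close>.
  \<open>J_r\<close>, in contrast, is explicit because its continuity yields the Lipschitz bound in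
  r.\<close>

definition J_t :: "real \<Rightarrow> real \<Rightarrow> real" where "J_t t r = deriv (\<lambda>t. J t r) t"
definition J_r :: "real \<Rightarrow> real \<Rightarrow> real" where "J_r t r = - (r * b t / (\<kappa> t r * sqrt (\<kappa> t r)))"
definition \<kappa>_t :: "real \<Rightarrow> real \<Rightarrow> real" where "\<kappa>_t t r = - 2 * r\<^sup>2 * H t * b t"
definition \<kappa>_r :: "real \<Rightarrow> real \<Rightarrow> real" where "\<kappa>_r t r = 2 * M / r\<^sup>2 + 2 * r * b t"

lemma J_has_derivative:
  assumes "(t, r) \<in> \<Omega>"
  shows "((\<lambda>p. J (fst p) (snd p)) has_derivative (\<lambda>d. J_t t r * fst d + J_r t r * snd d)) (at (t, r))"
proof -
  note \<Omega> = Omega_D[OF assms]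
  define C where "C = cubic M (b t) (1 / r) powr (-3/2)"
  have C: "C = r * r\<^sup>2 / (\<kappa> t r * sqrt (\<kappa> t r))"
    unfolding C_def powr_neg_three_halves[OF \<Omega>(6)] unfolding cubic_inverse[OF \<Omega>(2)]
    using \<Omega> by (simp add: real_sqrt_divide)
  obtain D where D: "((\<lambda>(b, X). Phi M b X) has_derivative (\<lambda>(db, dX). D * db + C * dX)) (at (b t, 1 / r))"
    unfolding C_def using Phi_has_derivative[of M "b t" "1 / r"] \<Omega> M_pos by auto
  have b: "((\<lambda>p. b (fst p)) has_derivative (\<lambda>d. - 2 * H t * b t * fst d)) (at (t, r))"
    by (rule has_derivative_compose_fst) (use DERIV_b[OF \<Omega>(1)] in simp)
  have r: "((\<lambda>p. 1 / snd p) has_derivative (\<lambda>d. - snd d / r\<^sup>2)) (at (t, r))"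
    using \<Omega> by (auto intro!: derivative_eq_intros simp: power2_eq_square field_simps)
  have "((\<lambda>p. (\<lambda>(b, X). Phi M b X) (b (fst p), 1 / snd p)) has_derivative
      (\<lambda>d. (\<lambda>(db, dX). D * db + C * dX) (- 2 * H t * b t * fst d, - snd d / r\<^sup>2))) (at (t, r))"
    by (rule has_derivative_compose[OF has_derivative_Pair[OF b r]]) (use D in simp)
  note J = has_derivative_mult[OF b this]
  define E where "E = b t * D * (- 2 * H t * b t) - 2 * H t * b t * Phi M (b t) (1 / r)"
  have J: "((\<lambda>p. J (fst p) (snd p)) has_derivative (\<lambda>d. E * fst d + J_r t r * snd d)) (at (t, r))"
    unfolding J_def using J unfolding case_prod_conv
    by (rule has_derivative_eq_rhs) (use \<Omega> in \<open>simp add: C fun_eq_iff J_r_def E_def algebra_simps\<close>)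
  \<comment> \<open>Restricting the total derivative to constant r identifies \<open>E\<close> with
    the \<open>deriv\<close> that defines \<open>J_t\<close>.\<close>
  have "((\<lambda>t. (t, r)) has_derivative (\<lambda>d. (d, 0))) (at t)"
    by (auto intro!: derivative_eq_intros)
  from has_derivative_compose[OF this J] have "((\<lambda>t. J t r) has_real_derivative E) (at t)"
    by (simp add: has_field_derivative_def)
  then have "J_t t r = E" unfolding J_t_def by (rule DERIV_imp_deriv)
  with J show ?thesis by simp
qed

lemma H_has_derivative:
  assumes "0 < t"
  shows "((\<lambda>p. H (fst p)) has_derivative (\<lambda>d. H' t * fst d)) (at (t, r))"
  by (rule has_derivative_compose_fst) (simp add: DERIV_H[OF assms])

lemma kappa_has_derivative:
  assumes "0 < t" "0 < r"
  shows "((\<lambda>p. \<kappa> (fst p) (snd p)) has_derivative (\<lambda>d. \<kappa>_t t r * fst d + \<kappa>_r t r * snd d)) (at (t, r))"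
proof -
  have b: "((\<lambda>p. b (fst p)) has_derivative (\<lambda>d. - 2 * H t * b t * fst d)) (at (t, r))"
    by (rule has_derivative_compose_fst) (use DERIV_b[OF assms(1)] in simp)
  have "((\<lambda>r. 1 - 2 * M / r) has_real_derivative 2 * M / r\<^sup>2) (at (snd (t, r)))"
    using assms by (auto intro!: derivative_eq_intros simp: power2_eq_square)
  note r = has_derivative_compose_snd[OF this]
  have "((\<lambda>r. r\<^sup>2) has_real_derivative 2 * r) (at (snd (t, r)))"
    by (auto intro!: derivative_eq_intros)
  note r2 = has_derivative_compose_snd[OF this]
  show ?thesis
    unfolding kappa_eq using has_derivative_add[OF r has_derivative_mult[OF r2 b]]
    by (rule has_derivative_eq_rhs) (simp add: fun_eq_iff \<kappa>_t_def \<kappa>_r_def algebra_simps)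
qed

lemma sqrt_kappa_has_derivative:
  assumes "(t, r) \<in> \<Omega>"
  shows "((\<lambda>p. sqrt (\<kappa> (fst p) (snd p))) has_derivative
    (\<lambda>d. \<kappa>_t t r / (2 * sqrt (\<kappa> t r)) * fst d + \<kappa>_r t r / (2 * sqrt (\<kappa> t r)) * snd d)) (at (t, r))"
proof -
  note \<Omega> = Omega_D[OF assms]
  have "(sqrt has_real_derivative 1 / (2 * sqrt (\<kappa> t r))) (at (\<kappa> (fst (t, r)) (snd (t, r))))"
    using \<Omega> DERIV_real_sqrt[of "\<kappa> t r"] by (simp add: field_simps)
  from has_derivative_compose[OF kappa_has_derivative[OF \<Omega>(1,2)] this[unfolded has_field_derivative_def]]
  show ?thesis
    by (rule has_derivative_eq_rhs) (use \<Omega> in \<open>simp add: fun_eq_iff field_simps\<close>)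
qed

definition speed_t :: "real \<Rightarrow> real \<Rightarrow> real" where
  "speed_t t r = J_t t r * (r * H t * sqrt (\<kappa> t r) - \<kappa> t r)
     + J t r * (r * H' t * sqrt (\<kappa> t r) + r * H t * (\<kappa>_t t r / (2 * sqrt (\<kappa> t r))) - \<kappa>_t t r)"
definition speed_r :: "real \<Rightarrow> real \<Rightarrow> real" where
  "speed_r t r = J_r t r * (r * H t * sqrt (\<kappa> t r) - \<kappa> t r)
     + J t r * (H t * sqrt (\<kappa> t r) + r * H t * (\<kappa>_r t r / (2 * sqrt (\<kappa> t r))) - \<kappa>_r t r)"

lemma speed_has_derivative:
  assumes "(t, r) \<in> \<Omega>"
  shows "((\<lambda>p. speed (fst p) (snd p)) has_derivative
    (\<lambda>d. speed_t t r * fst d + speed_r t r * snd d)) (at (t, r))"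
proof -
  note \<Omega> = Omega_D[OF assms]
  have "((\<lambda>p. snd p) has_derivative snd) (at (t, r))" by (auto intro!: derivative_eq_intros)
  from has_derivative_mult[OF J_has_derivative[OF assms] has_derivative_diff[OF has_derivative_mult[OF
      has_derivative_mult[OF this H_has_derivative[OF \<Omega>(1)]] sqrt_kappa_has_derivative[OF assms]]
      kappa_has_derivative[OF \<Omega>(1,2)]]]
  show ?thesis unfolding speed_def
    by (rule has_derivative_eq_rhs)
      (simp add: fun_eq_iff speed_t_def speed_r_def distrib_left distrib_right left_diff_distrib right_diff_distrib mult_ac)
qed

section \<open>Continuity and Lipschitz bounds of the null speed\<close>

lemma open_Omega: "open \<Omega>"
proof -
  have "continuous_on ({0<..} \<times> {0<..}) (\<lambda>p. \<kappa> (fst p) (snd p))"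
    by (intro continuous_at_imp_continuous_on)
      (auto intro!: has_derivative_continuous kappa_has_derivative)
  then have "open (({0<..} \<times> {0<..}) \<inter> (\<lambda>p. \<kappa> (fst p) (snd p)) -` {0<..})"
    by (rule continuous_open_preimage) (auto intro: open_Times)
  also have "({0<..} \<times> {0<..}) \<inter> (\<lambda>p. \<kappa> (fst p) (snd p)) -` {0<..} = \<Omega>"
    using Omega_iff by auto
  finally show ?thesis .
qed

lemma continuous_on_speed: "continuous_on \<Omega> (\<lambda>p. speed (fst p) (snd p))"
  by (intro continuous_at_imp_continuous_on)
    (auto intro!: has_derivative_continuous speed_has_derivative)

lemma continuous_on_speed_r: "continuous_on \<Omega> (\<lambda>p. speed_r (fst p) (snd p))"
proof -
  have "continuous_on \<Omega> (\<lambda>p. J (fst p) (snd p))" "continuous_on \<Omega> (\<lambda>p. \<kappa> (fst p) (snd p))"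
    "continuous_on \<Omega> (\<lambda>p. H (fst p))"
    by (auto intro!: continuous_at_imp_continuous_on has_derivative_continuous
        J_has_derivative kappa_has_derivative H_has_derivative dest: Omega_D)
  moreover have "continuous_on \<Omega> (\<lambda>p. b (fst p))"
    by (rule continuous_on_compose2[OF continuous_on_b]) (auto intro: continuous_intros dest: Omega_D)
  ultimately show ?thesis
    unfolding speed_r_def J_r_def \<kappa>_r_def
    by (intro continuous_intros) (auto dest: Omega_D)
qed

lemma Omega_convex_r:
  assumes "(t, r) \<in> \<Omega>" "r \<le> r'"
  shows "(t, r') \<in> \<Omega>"
  using assms by (auto simp: Omega_def)

lemma Omega_ge_2M: "0 < t \<Longrightarrow> 2 * M \<le> r \<Longrightarrow> (t, r) \<in> \<Omega>"
  using M_pos b_pos[of t] by (auto simp: Omega_iff kappa_eq intro!: add_nonneg_pos mult_pos_pos)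

text \<open>Mean value inequality with a bound of the continuous \<open>speed_r\<close> on K. K need
  not be convex in r, hence the condition on the whole segment: it is a rectangle in the existence
  proof and the region swept between two curves in the uniqueness proof.\<close>

lemma speed_lipschitz_compact:
  assumes K: "compact K" "K \<subseteq> \<Omega>"
  obtains L where "\<And>t x y. {t} \<times> closed_segment x y \<subseteq> K \<Longrightarrow> \<bar>speed t x - speed t y\<bar> \<le> L * \<bar>x - y\<bar>"
proof -
  have "compact ((\<lambda>p. speed_r (fst p) (snd p)) ` K)"
    by (intro compact_continuous_image continuous_on_subset[OF continuous_on_speed_r] K)
  then have "bounded ((\<lambda>p. speed_r (fst p) (snd p)) ` K)" by (rule compact_imp_bounded)
  then obtain L where "\<forall>y\<in>(\<lambda>p. speed_r (fst p) (snd p)) ` K. norm y \<le> L"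
    unfolding bounded_iff by blast
  then have L: "norm (speed_r (fst p) (snd p)) \<le> L" if "p \<in> K" for p using that by blast
  show thesis
  proof (rule that)
    fix t x y assume seg: "{t} \<times> closed_segment x y \<subseteq> K"
    have "norm (speed t x - speed t y) \<le> L * norm (x - y)"
    proof (rule field_differentiable_bound)
      fix z assume z: "z \<in> closed_segment x y"
      then have z\<Omega>: "(t, z) \<in> \<Omega>" using seg K by auto
      have "((\<lambda>r. (t, r)) has_derivative (\<lambda>d. (0, d))) (at z)"
        by (auto intro!: derivative_eq_intros)
      from has_derivative_compose[OF this speed_has_derivative[OF z\<Omega>]]
      have "(speed t has_real_derivative speed_r t z) (at z)"
        by (simp add: has_field_derivative_def)
      then show "(speed t has_field_derivative speed_r t z) (at z within closed_segment x y)"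
        by (rule has_field_derivative_at_within)
      show "norm (speed_r t z) \<le> L" using L[of "(t, z)"] seg z by (auto simp: subset_iff)
    qed auto
    then show "\<bar>speed t x - speed t y\<bar> \<le> L * \<bar>x - y\<bar>" by simp
  qed
qed

end

section \<open>Christoffel symbols in the radial plane\<close>

lemma vector_4:
  fixes x y z w :: "'a::zero"
  shows "(vector [x, y, z, w] :: 'a^4) $ 1 = x" "(vector [x, y, z, w] :: 'a^4) $ 2 = y"
    "(vector [x, y, z, w] :: 'a^4) $ 3 = z" "(vector [x, y, z, w] :: 'a^4) $ 4 = w"
  unfolding vector_def by simp_all

lemma matrix_inv_eqI:
  fixes A B :: "real^'n^'n"
  assumes "A ** B = mat 1"
  shows "matrix_inv A = B"
proof -
  have BA: "B ** A = mat 1" using assms matrix_left_right_inverse by blast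
  have "A ** matrix_inv A = mat 1 \<and> matrix_inv A ** A = mat 1"
    unfolding matrix_inv_def by (rule someI[of _ B]) (use assms BA in simp)
  then have "B ** (A ** matrix_inv A) = B ** mat 1" by simp
  then show ?thesis by (simp add: matrix_mul_assoc BA)
qed

text \<open>The entries \<open>axis i 1 $ 1\<close> and \<open>axis i 1 $ 2\<close> act as Kronecker
  deltas, so one formula serves all four directions. Agreement of F with G over an open set is
  enough, because the metric takes its form in terms of \<open>J\<close> only on
  \<open>Omega\<close>.\<close>

lemma partial_deriv_fun_of_two_coordinates:
  fixes x :: "real^4"
  assumes G: "((\<lambda>p. G (fst p) (snd p)) has_derivative (\<lambda>d. D\<^sub>1 * fst d + D\<^sub>2 * snd d)) (at (x $ 1, x $ 2))"
    and U: "open U" "(x $ 1, x $ 2) \<in> U" "\<And>y. (y $ 1, y $ 2) \<in> U \<Longrightarrow> F y = G (y $ 1) (y $ 2)"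
  shows "partial_deriv F i x = D\<^sub>1 * (axis i 1 $ 1) + D\<^sub>2 * (axis i 1 $ 2)"
proof -
  let ?c = "\<lambda>h. (x $ 1 + h * axis i 1 $ 1, x $ 2 + h * axis i 1 $ 2)"
  have "(?c has_derivative (\<lambda>d. (d * axis i 1 $ 1, d * axis i 1 $ 2))) (at 0)"
    by (auto intro!: derivative_eq_intros)
  moreover have "((\<lambda>p. G (fst p) (snd p)) has_derivative (\<lambda>d. D\<^sub>1 * fst d + D\<^sub>2 * snd d)) (at (?c 0))"
    using G by simp
  ultimately have "((\<lambda>h. (\<lambda>p. G (fst p) (snd p)) (?c h)) has_derivative
      (\<lambda>d. (\<lambda>d. D\<^sub>1 * fst d + D\<^sub>2 * snd d) (d * axis i 1 $ 1, d * axis i 1 $ 2))) (at 0)"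
    by (rule has_derivative_compose)
  then have *: "((\<lambda>h. G (fst (?c h)) (snd (?c h))) has_real_derivative D\<^sub>1 * (axis i 1 $ 1) + D\<^sub>2 * (axis i 1 $ 2)) (at 0)"
    unfolding has_field_derivative_def
    by (rule has_derivative_eq_rhs) (simp add: fun_eq_iff algebra_simps)
  have "((\<lambda>h. F (x + h *\<^sub>R axis i 1)) has_real_derivative D\<^sub>1 * (axis i 1 $ 1) + D\<^sub>2 * (axis i 1 $ 2)) (at 0)"
  proof (rule has_field_derivative_transform_within_open[OF *])
    have "continuous_on UNIV ?c" by (intro continuous_intros)
    then show "open (?c -` U)" by (intro open_vimage U(1))
    show "0 \<in> ?c -` U" using U(2) by simp
    show "G (fst (?c h)) (snd (?c h)) = F (x + h *\<^sub>R axis i 1)" if "h \<in> ?c -` U" for h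
      using that by (subst U(3)) auto
  qed
  then show ?thesis unfolding partial_deriv_def by (rule DERIV_imp_deriv)
qed

context mcvittie
begin

text \<open>The square is written as a product so that the product rule applies to it
  directly.\<close>

definition chi :: "real \<Rightarrow> real \<Rightarrow> real" where "chi t r = \<kappa> t r - r * H t * (r * H t)"
text \<open>The components after inserting sigma = H sqrt(kappa) J, which removes the H^(-2) of the
  original metric.\<close>

definition g\<^sub>1\<^sub>1 :: "real \<Rightarrow> real \<Rightarrow> real" where "g\<^sub>1\<^sub>1 t r = - (J t r * J t r * chi t r)"
definition g\<^sub>1\<^sub>2 :: "real \<Rightarrow> real \<Rightarrow> real" where "g\<^sub>1\<^sub>2 t r = - (r * H t * J t r / sqrt (\<kappa> t r))"
definition g\<^sub>2\<^sub>2 :: "real \<Rightarrow> real \<Rightarrow> real" where "g\<^sub>2\<^sub>2 t r = 1 / \<kappa> t r"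

lemma metric_components:
  assumes "(x $ 1, x $ 2) \<in> \<Omega>"
  shows "mcvittie_metric M a x $ 1 $ 1 = g\<^sub>1\<^sub>1 (x $ 1) (x $ 2)"
    "mcvittie_metric M a x $ 1 $ 2 = g\<^sub>1\<^sub>2 (x $ 1) (x $ 2)"
    "mcvittie_metric M a x $ 2 $ 1 = g\<^sub>1\<^sub>2 (x $ 1) (x $ 2)"
    "mcvittie_metric M a x $ 2 $ 2 = g\<^sub>2\<^sub>2 (x $ 1) (x $ 2)"
proof -
  note \<Omega> = Omega_D[OF assms]
  define s where "s = sqrt (\<kappa> (x $ 1) (x $ 2))"
  have s: "0 < s" "\<kappa> (x $ 1) (x $ 2) = s * s" using \<Omega> by (auto simp: s_def)
  show "mcvittie_metric M a x $ 1 $ 1 = g\<^sub>1\<^sub>1 (x $ 1) (x $ 2)"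
    "mcvittie_metric M a x $ 1 $ 2 = g\<^sub>1\<^sub>2 (x $ 1) (x $ 2)"
    "mcvittie_metric M a x $ 2 $ 1 = g\<^sub>1\<^sub>2 (x $ 1) (x $ 2)"
    "mcvittie_metric M a x $ 2 $ 2 = g\<^sub>2\<^sub>2 (x $ 1) (x $ 2)"
    unfolding mcvittie_metric_def Let_def vector_4 sigma_eq[OF assms] g\<^sub>1\<^sub>1_def g\<^sub>1\<^sub>2_def g\<^sub>2\<^sub>2_def chi_def
      s_def[symmetric] s(2)
    using s(1) \<Omega>(1,2,5) by (simp_all add: field_simps power2_eq_square)
qed

lemma metric_components_0:
  "mcvittie_metric M a x $ 1 $ 3 = 0" "mcvittie_metric M a x $ 1 $ 4 = 0"
  "mcvittie_metric M a x $ 2 $ 3 = 0" "mcvittie_metric M a x $ 2 $ 4 = 0"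
  "mcvittie_metric M a x $ 3 $ 1 = 0" "mcvittie_metric M a x $ 3 $ 2 = 0" "mcvittie_metric M a x $ 3 $ 4 = 0"
  "mcvittie_metric M a x $ 4 $ 1 = 0" "mcvittie_metric M a x $ 4 $ 2 = 0" "mcvittie_metric M a x $ 4 $ 3 = 0"
  "mcvittie_metric M a x $ 3 $ 3 = (x $ 2)\<^sup>2" "mcvittie_metric M a x $ 4 $ 4 = (x $ 2)\<^sup>2 * (sin (x $ 3))\<^sup>2"
  unfolding mcvittie_metric_def Let_def vector_4 by simp_all

text \<open>The (t, r) block has determinant -J^2, which produces these entries; on the domain sin
  of the polar angle is positive, so the angular block is invertible too.\<close>

lemma matrix_inv_metric:
  assumes "x \<in> mcvittie_domain M a" "t = x $ 1" "r = x $ 2"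
  shows "matrix_inv (mcvittie_metric M a x) = vector
    [vector [- 1 / (\<kappa> t r * (J t r)\<^sup>2), - r * H t / (sqrt (\<kappa> t r) * J t r), 0, 0],
     vector [- r * H t / (sqrt (\<kappa> t r) * J t r), chi t r, 0, 0],
     vector [0, 0, 1 / r\<^sup>2, 0],
     vector [0, 0, 0, 1 / (r\<^sup>2 * (sin (x $ 3))\<^sup>2)]]"
proof -
  have in\<Omega>: "(x $ 1, x $ 2) \<in> \<Omega>" and sin: "0 < sin (x $ 3)"
    using assms(1) by (auto simp: mcvittie_domain_def sin_gt_zero)
  have \<Omega>': "(t, r) \<in> \<Omega>" using in\<Omega> assms(2,3) by simp
  note \<Omega> = Omega_D[OF \<Omega>']
  define s where "s = sqrt (\<kappa> t r)"
  have s: "0 < s" "\<kappa> t r = s * s" using \<Omega> by (auto simp: s_def)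
  show ?thesis
    by (rule matrix_inv_eqI, unfold vec_eq_iff forall_4 matrix_matrix_mult_def mat_def vec_lambda_beta sum_4
        vector_4 metric_components[OF in\<Omega>] metric_components_0 g\<^sub>1\<^sub>1_def g\<^sub>1\<^sub>2_def g\<^sub>2\<^sub>2_def chi_def
        assms(2,3)[symmetric] s_def[symmetric] s(2))
      (use s(1) \<Omega>(1,2,5) J_pos[OF \<Omega>'] sin in \<open>simp add: field_simps power2_eq_square\<close>)
qed

definition g\<^sub>1\<^sub>1_t :: "real \<Rightarrow> real \<Rightarrow> real" where
  "g\<^sub>1\<^sub>1_t t r = - 2 * J t r * J_t t r * chi t r - (J t r)\<^sup>2 * (\<kappa>_t t r - 2 * r\<^sup>2 * H t * H' t)"
definition g\<^sub>1\<^sub>1_r :: "real \<Rightarrow> real \<Rightarrow> real" where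
  "g\<^sub>1\<^sub>1_r t r = - 2 * J t r * J_r t r * chi t r - (J t r)\<^sup>2 * (\<kappa>_r t r - 2 * r * (H t)\<^sup>2)"
definition g\<^sub>1\<^sub>2_t :: "real \<Rightarrow> real \<Rightarrow> real" where
  "g\<^sub>1\<^sub>2_t t r = - (r * (H' t * J t r + H t * J_t t r) / sqrt (\<kappa> t r))
     + r * H t * J t r * \<kappa>_t t r / (2 * (\<kappa> t r * sqrt (\<kappa> t r)))"
definition g\<^sub>1\<^sub>2_r :: "real \<Rightarrow> real \<Rightarrow> real" where
  "g\<^sub>1\<^sub>2_r t r = - ((H t * J t r + r * H t * J_r t r) / sqrt (\<kappa> t r))
     + r * H t * J t r * \<kappa>_r t r / (2 * (\<kappa> t r * sqrt (\<kappa> t r)))"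
definition g\<^sub>2\<^sub>2_t :: "real \<Rightarrow> real \<Rightarrow> real" where "g\<^sub>2\<^sub>2_t t r = - \<kappa>_t t r / (\<kappa> t r)\<^sup>2"
definition g\<^sub>2\<^sub>2_r :: "real \<Rightarrow> real \<Rightarrow> real" where "g\<^sub>2\<^sub>2_r t r = - \<kappa>_r t r / (\<kappa> t r)\<^sup>2"

lemma metric_components_have_derivative:
  assumes "(t, r) \<in> \<Omega>"
  shows "((\<lambda>p. g\<^sub>1\<^sub>1 (fst p) (snd p)) has_derivative (\<lambda>d. g\<^sub>1\<^sub>1_t t r * fst d + g\<^sub>1\<^sub>1_r t r * snd d)) (at (t, r))"
    and "((\<lambda>p. g\<^sub>1\<^sub>2 (fst p) (snd p)) has_derivative (\<lambda>d. g\<^sub>1\<^sub>2_t t r * fst d + g\<^sub>1\<^sub>2_r t r * snd d)) (at (t, r))"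
    and "((\<lambda>p. g\<^sub>2\<^sub>2 (fst p) (snd p)) has_derivative (\<lambda>d. g\<^sub>2\<^sub>2_t t r * fst d + g\<^sub>2\<^sub>2_r t r * snd d)) (at (t, r))"
proof -
  note \<Omega> = Omega_D[OF assms]
  note J = J_has_derivative[OF assms] and \<kappa> = kappa_has_derivative[OF \<Omega>(1,2)]
    and s = sqrt_kappa_has_derivative[OF assms]
  have "((\<lambda>p. snd p) has_derivative snd) (at (t, r))" by (auto intro!: derivative_eq_intros)
  note rH = has_derivative_mult[OF this H_has_derivative[OF \<Omega>(1)]]
  show "((\<lambda>p. g\<^sub>1\<^sub>1 (fst p) (snd p)) has_derivative (\<lambda>d. g\<^sub>1\<^sub>1_t t r * fst d + g\<^sub>1\<^sub>1_r t r * snd d)) (at (t, r))"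
    unfolding g\<^sub>1\<^sub>1_def chi_def
    using has_derivative_minus[OF has_derivative_mult[OF has_derivative_mult[OF J J]
      has_derivative_diff[OF \<kappa> has_derivative_mult[OF rH rH]]]]
    by (rule has_derivative_eq_rhs)
      (simp add: fun_eq_iff g\<^sub>1\<^sub>1_t_def g\<^sub>1\<^sub>1_r_def chi_def power2_eq_square algebra_simps)
  define q where "q = sqrt (\<kappa> t r)"
  have q: "0 < q" "\<kappa> t r = q * q" using \<Omega> by (auto simp: q_def)
  show "((\<lambda>p. g\<^sub>1\<^sub>2 (fst p) (snd p)) has_derivative (\<lambda>d. g\<^sub>1\<^sub>2_t t r * fst d + g\<^sub>1\<^sub>2_r t r * snd d)) (at (t, r))"
    unfolding g\<^sub>1\<^sub>2_def
    by (rule has_derivative_eq_rhs[OF has_derivative_minus[OF has_derivative_divide'[OF has_derivative_mult[OF rH J] s]]])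
      (use \<Omega>(3) q(1) in \<open>simp_all add: fun_eq_iff g\<^sub>1\<^sub>2_t_def g\<^sub>1\<^sub>2_r_def q_def[symmetric] q(2) field_simps\<close>)
  show "((\<lambda>p. g\<^sub>2\<^sub>2 (fst p) (snd p)) has_derivative (\<lambda>d. g\<^sub>2\<^sub>2_t t r * fst d + g\<^sub>2\<^sub>2_r t r * snd d)) (at (t, r))"
    unfolding g\<^sub>2\<^sub>2_def
    by (rule has_derivative_eq_rhs[OF has_derivative_divide'[OF has_derivative_const \<kappa>]])
      (use \<Omega> in \<open>auto simp: fun_eq_iff g\<^sub>2\<^sub>2_t_def g\<^sub>2\<^sub>2_r_def power2_eq_square field_simps\<close>)
qed

lemma partial_deriv_metric:
  assumes "(x $ 1, x $ 2) \<in> \<Omega>" "t = x $ 1" "r = x $ 2"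
  shows "partial_deriv (\<lambda>y. mcvittie_metric M a y $ 1 $ 1) i x = g\<^sub>1\<^sub>1_t t r * axis i 1 $ 1 + g\<^sub>1\<^sub>1_r t r * axis i 1 $ 2"
    "partial_deriv (\<lambda>y. mcvittie_metric M a y $ 1 $ 2) i x = g\<^sub>1\<^sub>2_t t r * axis i 1 $ 1 + g\<^sub>1\<^sub>2_r t r * axis i 1 $ 2"
    "partial_deriv (\<lambda>y. mcvittie_metric M a y $ 2 $ 1) i x = g\<^sub>1\<^sub>2_t t r * axis i 1 $ 1 + g\<^sub>1\<^sub>2_r t r * axis i 1 $ 2"
    "partial_deriv (\<lambda>y. mcvittie_metric M a y $ 2 $ 2) i x = g\<^sub>2\<^sub>2_t t r * axis i 1 $ 1 + g\<^sub>2\<^sub>2_r t r * axis i 1 $ 2"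
  unfolding assms(2,3)
  by (rule partial_deriv_fun_of_two_coordinates[OF metric_components_have_derivative(1)[OF assms(1)]
        open_Omega assms(1) metric_components(1)], assumption)
    (rule partial_deriv_fun_of_two_coordinates[OF metric_components_have_derivative(2)[OF assms(1)]
        open_Omega assms(1) metric_components(2)]
      partial_deriv_fun_of_two_coordinates[OF metric_components_have_derivative(2)[OF assms(1)]
        open_Omega assms(1) metric_components(3)]
      partial_deriv_fun_of_two_coordinates[OF metric_components_have_derivative(3)[OF assms(1)]
        open_Omega assms(1) metric_components(4)], assumption)+

lemma partial_deriv_const: "partial_deriv (\<lambda>y. c) i x = 0"
  by (simp add: partial_deriv_def)

text \<open>The two brackets are the contracted Christoffel symbols of the first kind for l = 1 and
  l = 2. Those for l = 3 and l = 4 vanish, because the radial block depends on no angle and has no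
  cross terms with the angular one.\<close>

lemma christoffel_contraction:
  assumes x: "x \<in> mcvittie_domain M a" "t = x $ 1" "r = x $ 2" and u: "u $ 3 = 0" "u $ 4 = 0"
  shows "(\<Sum>j\<in>UNIV. \<Sum>k\<in>UNIV. christoffel (mcvittie_metric M a) x i j k * u $ j * u $ k) =
    matrix_inv (mcvittie_metric M a x) $ i $ 1 *
      (g\<^sub>1\<^sub>1_t t r / 2 * (u $ 1)\<^sup>2 + g\<^sub>1\<^sub>1_r t r * (u $ 1 * u $ 2) + (g\<^sub>1\<^sub>2_r t r - g\<^sub>2\<^sub>2_t t r / 2) * (u $ 2)\<^sup>2)
    + matrix_inv (mcvittie_metric M a x) $ i $ 2 *
      ((g\<^sub>1\<^sub>2_t t r - g\<^sub>1\<^sub>1_r t r / 2) * (u $ 1)\<^sup>2 + g\<^sub>2\<^sub>2_t t r * (u $ 1 * u $ 2) + g\<^sub>2\<^sub>2_r t r / 2 * (u $ 2)\<^sup>2)"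
proof -
  have x': "(x $ 1, x $ 2) \<in> \<Omega>" using x(1) by (simp add: mcvittie_domain_def)
  have "(\<Sum>j\<in>UNIV. \<Sum>k\<in>UNIV. christoffel (mcvittie_metric M a) x i j k * u $ j * u $ k) =
    christoffel (mcvittie_metric M a) x i 1 1 * (u $ 1)\<^sup>2 +
    (christoffel (mcvittie_metric M a) x i 1 2 + christoffel (mcvittie_metric M a) x i 2 1) * (u $ 1 * u $ 2) +
    christoffel (mcvittie_metric M a) x i 2 2 * (u $ 2)\<^sup>2"
    unfolding sum_4 u by (simp add: power2_eq_square algebra_simps)
  then show ?thesis
    unfolding christoffel_def sum_4 partial_deriv_metric[OF x' x(2,3)] metric_components_0 partial_deriv_const
    by (simp add: axis_def algebra_simps)
qed

text \<open>The radial component is the Raychaudhuri equation.  The time component equals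
  \<open>d/ds\<close> of \<open>(dr/ds) / speed\<close>; it is multiplied by the speed because this may vanish outside the
  regular region.\<close>

lemma radial_null_acceleration:
  assumes x: "x \<in> mcvittie_domain M a" "t = x $ 1" "r = x $ 2"
    and u: "u $ 2 = speed t r * u $ 1" "u $ 3 = 0" "u $ 4 = 0"
  defines "\<Gamma> \<equiv> \<lambda>i. \<Sum>j\<in>UNIV. \<Sum>k\<in>UNIV. christoffel (mcvittie_metric M a) x i j k * u $ j * u $ k"
  shows "- \<Gamma> 2 = (u $ 1)\<^sup>2 * (J t r * r * sqrt (\<kappa> t r) * (H' t + b t))"
    and "speed t r * - \<Gamma> 1 = - \<Gamma> 2 - (u $ 1)\<^sup>2 * (speed_t t r + speed t r * speed_r t r)"
    and "\<Gamma> 3 = 0" "\<Gamma> 4 = 0"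
proof -
  have \<Omega>': "(t, r) \<in> \<Omega>" using x by (simp add: mcvittie_domain_def)
  note \<Omega> = Omega_D[OF \<Omega>'] and J = J_pos[OF \<Omega>']
  define s where "s = sqrt (\<kappa> t r)"
  have s: "0 < s" "\<kappa> t r = s * s" using \<Omega> by (auto simp: s_def)
  have \<Gamma>: "\<Gamma> i = matrix_inv (mcvittie_metric M a x) $ i $ 1 *
      (g\<^sub>1\<^sub>1_t t r / 2 * (u $ 1)\<^sup>2 + g\<^sub>1\<^sub>1_r t r * (u $ 1 * u $ 2) + (g\<^sub>1\<^sub>2_r t r - g\<^sub>2\<^sub>2_t t r / 2) * (u $ 2)\<^sup>2)
    + matrix_inv (mcvittie_metric M a x) $ i $ 2 *
      ((g\<^sub>1\<^sub>2_t t r - g\<^sub>1\<^sub>1_r t r / 2) * (u $ 1)\<^sup>2 + g\<^sub>2\<^sub>2_t t r * (u $ 1 * u $ 2) + g\<^sub>2\<^sub>2_r t r / 2 * (u $ 2)\<^sup>2)" for i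
    unfolding \<Gamma>_def by (rule christoffel_contraction[OF x u(2,3)])
  show "\<Gamma> 3 = 0" "\<Gamma> 4 = 0"
    unfolding \<Gamma> matrix_inv_metric[OF x] vector_4 by simp_all
  \<comment> \<open>With sqrt(kappa) as an atom s and kappa = s^2, both claims become rational
    identities in independent letters; \<open>jt\<close>, \<open>h'\<close> and \<open>kr\<close>
    may have any value.\<close>
  define p jt h' kr where "p = u $ 1" and "jt = J_t t r" and "h' = H' t" and "kr = \<kappa>_r t r"
  define j h B where "j = J t r" and "h = H t" and "B = b t"
  have pos: "0 < j" "0 < h" "0 < r" "0 < B" using J \<Omega> by (auto simp: j_def h_def B_def)
  note folds = p_def[symmetric] jt_def[symmetric] h'_def[symmetric] kr_def[symmetric]
    j_def[symmetric] h_def[symmetric] B_def[symmetric] s_def[symmetric]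
  note defs = g\<^sub>1\<^sub>1_t_def g\<^sub>1\<^sub>1_r_def g\<^sub>1\<^sub>2_t_def g\<^sub>1\<^sub>2_r_def g\<^sub>2\<^sub>2_t_def g\<^sub>2\<^sub>2_r_def speed_def speed_t_def speed_r_def chi_def
    J_r_def \<kappa>_t_def
  show 2: "- \<Gamma> 2 = (u $ 1)\<^sup>2 * (J t r * r * sqrt (\<kappa> t r) * (H' t + b t))"
    unfolding \<Gamma> matrix_inv_metric[OF x] vector_4 u defs folds s(2)
    using s(1) pos by (simp add: field_simps power2_eq_square)
  show "speed t r * - \<Gamma> 1 = - \<Gamma> 2 - (u $ 1)\<^sup>2 * (speed_t t r + speed t r * speed_r t r)"
    unfolding 2 unfolding \<Gamma> matrix_inv_metric[OF x] vector_4 u defs folds s(2)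
    using s(1) pos by (simp add: field_simps power2_eq_square)
qed

text \<open>For v = dr/dt and s = sqrt(kappa) the quadratic form is (dt/ds)^2 times (v / s - r H
  J)^2 - J^2 s^2, and \<open>speed\<close> is its ingoing root v / s - r H J = - J s.\<close>

lemma radial_null_vector:
  assumes "(x $ 1, x $ 2) \<in> \<Omega>" "u $ 2 = speed (x $ 1) (x $ 2) * u $ 1" "u $ 3 = 0" "u $ 4 = 0"
  shows "u \<bullet> (mcvittie_metric M a x *v u) = 0"
proof -
  note \<Omega> = Omega_D[OF assms(1)]
  define s where "s = sqrt (\<kappa> (x $ 1) (x $ 2))"
  have s: "0 < s" "\<kappa> (x $ 1) (x $ 2) = s * s" using \<Omega> by (auto simp: s_def)
  show ?thesis
    unfolding inner_vec_def matrix_vector_mult_def vec_lambda_beta sum_4 metric_components[OF assms(1)]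
      metric_components_0 assms(2-4) g\<^sub>1\<^sub>1_def g\<^sub>1\<^sub>2_def g\<^sub>2\<^sub>2_def chi_def speed_def s_def[symmetric] s(2)
    using s(1) by (simp add: field_simps)
qed

end

section \<open>Trapping in the regular region and the limit\<close>

lemma antimono_tendsto_at_top:
  fixes f :: "real \<Rightarrow> real"
  assumes "\<And>x y. c \<le> x \<Longrightarrow> x \<le> y \<Longrightarrow> f y \<le> f x" "\<And>x. c \<le> x \<Longrightarrow> m \<le> f x"
  obtains L where "(f \<longlongrightarrow> L) at_top" "\<And>x. c \<le> x \<Longrightarrow> L \<le> f x" "m \<le> L"
proof -
  define L where "L = (INF x\<in>{c..}. f x)"
  have bdd: "bdd_below (f ` {c..})" using assms(2) by (auto intro!: bdd_belowI)
  have le: "L \<le> f x" if "c \<le> x" for x unfolding L_def by (rule cINF_lower[OF bdd]) (use that in simp)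
  have "(f \<longlongrightarrow> L) at_top"
  proof (rule order_tendstoI)
    fix y assume "y < L"
    then show "\<forall>\<^sub>F x in at_top. y < f x"
      by (auto intro!: eventually_at_top_linorderI[of c] dest: le)
  next
    fix y assume "L < y"
    then obtain z where "c \<le> z" "f z < y"
      using cINF_less_iff[OF _ bdd, of y] unfolding L_def by auto
    then show "\<forall>\<^sub>F x in at_top. f x < y"
      using assms(1)[of z] by (fastforce intro!: eventually_at_top_linorderI[of z])
  qed
  moreover have "m \<le> L" unfolding L_def by (rule cINF_greatest) (use assms(2) in auto)
  ultimately show thesis using le that by blast
qed

text \<open>The zero set is compact and so has a least element; the intermediate value theorem
  excludes nonpositive values before it. This supports the first-exit arguments below.\<close>

lemma first_zero:
  fixes m :: "real \<Rightarrow> real"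
  assumes cont: "continuous_on {c..d} m" and "c \<le> d" "0 < m c" "m d \<le> 0"
  obtains s where "c < s" "s \<le> d" "m s = 0" "\<And>t. c \<le> t \<Longrightarrow> t < s \<Longrightarrow> 0 < m t"
proof -
  let ?Z = "{t \<in> {c..d}. m t = 0}"
  have ivt: "\<exists>z\<ge>c. z \<le> t \<and> m z = 0" if "t \<in> {c..d}" "m t \<le> 0" for t
    using that assms by (intro IVT2') (auto intro: continuous_on_subset[OF cont])
  have "closed ?Z"
    using continuous_closed_preimage_constant[OF cont, of 0] by simp
  moreover have "bounded ?Z" by (rule bounded_subset[of "{c..d}"]) auto
  ultimately have "compact ?Z" by (simp add: compact_eq_bounded_closed)
  moreover have "?Z \<noteq> {}" using ivt[of d] assms by auto
  ultimately obtain s where s: "s \<in> ?Z" "\<And>t. t \<in> ?Z \<Longrightarrow> s \<le> t"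
    using compact_attains_inf[of ?Z] by blast
  show thesis
  proof (rule that[of s])
    show "c < s" using s(1) assms(3) by (cases "s = c") auto
    fix t assume t: "c \<le> t" "t < s"
    show "0 < m t"
    proof (rule ccontr)
      assume "\<not> 0 < m t"
      then obtain z where "c \<le> z" "z \<le> t" "m z = 0" using ivt[of t] t s(1) by auto
      then show False using s(2)[of z] t s(1) by auto
    qed
  qed (use s in auto)
qed

context mcvittie
begin

section \<open>Monotonicity and large-time limits of a, H and N\<close>

lemma a_strict_mono: "0 < s \<Longrightarrow> s < t \<Longrightarrow> a s < a t"
  by (rule DERIV_pos_imp_increasing) (auto intro!: exI[of _ "H x * a x" for x] DERIV_a mult_pos_pos hubble_pos a_pos)

lemma H_antimono:
  assumes "0 < s" "s \<le> t"
  shows "H t \<le> H s"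
proof (rule DERIV_nonpos_imp_nonincreasing[OF assms(2)])
  fix z assume "s \<le> z"
  with assms have "0 < z" by simp
  then show "\<exists>y. (H has_real_derivative y) (at z) \<and> y \<le> 0"
    using DERIV_H[of z] NEC[of z] b_pos[of z] by (intro exI[of _ "H' z"]) auto
qed

lemma N_strict_antimono:
  assumes "0 < s" "s < t"
  shows "N t < N s"
proof (rule DERIV_neg_imp_decreasing[OF assms(2)])
  fix z assume "s \<le> z"
  with assms have "0 < z" by simp
  then show "\<exists>y. (N has_real_derivative y) (at z) \<and> y < 0"
    using DERIV_N[of z] NEC[of z] hubble_pos[of z]
    by (intro exI[of _ "2 * H z * (H' z + b z)"]) (auto intro: mult_pos_neg)
qed

text \<open>If \<open>a\<close> were bounded, then \<open>H' < -1/a\<^sup>2\<close> would make \<open>H\<close> negative.\<close>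

lemma filterlim_a_at_top: "filterlim a at_top at_top"
proof (rule ccontr)
  assume "\<not> filterlim a at_top at_top"
  then obtain Z where Z: "\<not> (\<forall>\<^sub>F t in at_top. Z \<le> a t)" by (auto simp: filterlim_at_top)
  have less: "a t < Z" if "0 < t" for t
  proof (rule ccontr)
    assume "\<not> a t < Z"
    then have "Z \<le> a u" if "t \<le> u" for u
      using a_strict_mono[of t u] that \<open>0 < t\<close> by (cases "t = u") auto
    with Z show False by (auto intro: eventually_at_top_linorderI)
  qed
  have "0 < Z" using less[of 1] a_pos[of 1] by simp
  \<comment> \<open>With H' <= -1 / Z^2, H would lose its whole value at time 1 within this
    time.\<close>
  define T where "T = H 1 * Z\<^sup>2"
  have "0 < T" using hubble_pos[of 1] \<open>0 < Z\<close> by (simp add: T_def)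
  obtain z where z: "1 < z" "z < 1 + T" "H (1 + T) - H 1 = H' z * ((1 + T) - 1)"
    using mvt_within[of 1 "1 + T" UNIV H H'] \<open>0 < T\<close> DERIV_H by auto
  have "1 / Z\<^sup>2 \<le> b z" unfolding b_def
    using less[of z] a_pos[of z] z \<open>0 < Z\<close> by (intro divide_left_mono power_mono) auto
  then have "H' z \<le> - (1 / Z\<^sup>2)" using NEC[of z] z by simp
  then have "H' z * T \<le> - (1 / Z\<^sup>2) * T" using \<open>0 < T\<close> by (intro mult_right_mono) auto
  also have "\<dots> = - H 1" using \<open>0 < Z\<close> by (simp add: T_def)
  finally have "H (1 + T) \<le> 0" using z(3) by simp
  with hubble_pos[of "1 + T"] \<open>0 < T\<close> show False by simp
qed

lemma b_tendsto: "(b \<longlongrightarrow> 0) at_top"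
  unfolding b_def[abs_def]
  by (rule tendsto_divide_0[OF tendsto_const])
    (intro filterlim_at_top_imp_at_infinity filterlim_pow_at_top filterlim_a_at_top; simp)

lemma H_tendsto: "(H \<longlongrightarrow> H_inf a) at_top" and H_inf_nonneg: "0 \<le> H_inf a"
proof -
  obtain L where L: "(H \<longlongrightarrow> L) at_top" "0 \<le> L"
    using antimono_tendsto_at_top[of 1 H 0] H_antimono hubble_pos less_imp_le
    by (metis less_le_trans zero_less_one)
  have "H_inf a = L" unfolding H_inf_def by (rule tendsto_Lim[OF trivial_limit_at_top_linorder L(1)])
  with L show "(H \<longlongrightarrow> H_inf a) at_top" "0 \<le> H_inf a" by auto
qed

lemma N_tendsto: "(N \<longlongrightarrow> (H_inf a)\<^sup>2) at_top"
  unfolding N_def[abs_def] by (auto intro!: tendsto_eq_intros H_tendsto b_tendsto)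

lemma N_gt: "0 < t \<Longrightarrow> (H_inf a)\<^sup>2 < N t"
proof -
  assume t: "0 < t"
  \<comment> \<open>Passing to the limit gives a weak inequality only; taken at t + 1, it becomes
    strict at t by the strict decrease of N.\<close>
  have "(H_inf a)\<^sup>2 \<le> N (t + 1)"
  proof (rule tendsto_upperbound[OF N_tendsto _ trivial_limit_at_top_linorder])
    show "\<forall>\<^sub>F u in at_top. N u \<le> N (t + 1)"
      using eventually_gt_at_top[of "t + 1"]
      by eventually_elim (use N_strict_antimono[of "t + 1"] t in \<open>simp add: less_imp_le\<close>)
  qed
  also have "\<dots> < N t" using N_strict_antimono[of t "t + 1"] t by simp
  finally show ?thesis .
qed

lemma N_pos: "0 < t \<Longrightarrow> 0 < N t"
  using N_gt[of t] by (meson le_less_trans zero_le_power2)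

section \<open>The regular region and the sign of dr/dt\<close>

lemma chi_eq: "chi t r = 1 - 2 * M / r - r\<^sup>2 * N t"
  by (simp add: chi_def kappa_eq N_def algebra_simps power2_eq_square)

text \<open>As N is positive, chi > 0 forces 2 M / r < 1. Conversely r > 2 M already gives kappa >
  0, so the radius \<open>r1\<close> disappears from the later arguments.\<close>

lemma regular_region_iff:
  "(t, r) \<in> regular_region M a \<longleftrightarrow> 0 < t \<and> 2 * M < r \<and> 0 < chi t r"
proof
  assume "(t, r) \<in> regular_region M a"
  then have *: "(t, r) \<in> \<Omega>" "0 < chi t r"
    by (auto simp: regular_region_def chi_def power2_eq_square mult_ac)
  note \<Omega> = Omega_D[OF *(1)]
  have "0 \<le> r\<^sup>2 * N t" using N_pos[OF \<Omega>(1)] by simp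
  then have "2 * M / r < 1" using * by (simp add: chi_eq)
  then show "0 < t \<and> 2 * M < r \<and> 0 < chi t r" using * \<Omega> by (simp add: field_simps)
next
  assume "0 < t \<and> 2 * M < r \<and> 0 < chi t r"
  then show "(t, r) \<in> regular_region M a"
    using Omega_ge_2M[of t r] by (auto simp: regular_region_def chi_def power2_eq_square mult_ac)
qed

text \<open>Multiplying r H - sqrt(kappa) by its conjugate exposes the factor chi, which decides the
  sign of dr/dt.\<close>

lemma speed_eq_chi:
  assumes "(t, r) \<in> \<Omega>"
  shows "speed t r = - (J t r * sqrt (\<kappa> t r) * chi t r / (r * H t + sqrt (\<kappa> t r)))"
proof -
  note \<Omega> = Omega_D[OF assms]
  define s where "s = sqrt (\<kappa> t r)"
  have s: "0 < s" "\<kappa> t r = s * s" using \<Omega> by (auto simp: s_def)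
  have "0 < r * H t + s" using s(1) \<Omega> by (simp add: add_pos_pos)
  then show ?thesis
    unfolding speed_def chi_def s_def[symmetric] s(2) by (simp add: field_simps)
qed

lemma speed_neg: "(t, r) \<in> \<Omega> \<Longrightarrow> 0 < chi t r \<Longrightarrow> speed t r < 0"
  using Omega_D[of t r] J_pos[of t r] by (simp add: speed_eq_chi add_pos_pos)

text \<open>On \<open>r \<ge> 2M\<close> the speed is smooth, so clamping its argument to \<open>[2M, r\<^sub>0]\<close> gives a globally
  Lipschitz equation.  A solution cannot reach \<open>\<chi> = 0\<close>, because there \<open>dr/dt = 0\<close> while \<open>\<chi>\<close>
  grows with \<open>t\<close> at fixed \<open>r\<close>.\<close>

lemma ingoing_solution_exists:
  assumes reg: "(t\<^sub>0, r\<^sub>0) \<in> regular_region M a"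
  shows "\<exists>x. x t\<^sub>0 = r\<^sub>0 \<and>
    (\<forall>t\<ge>t\<^sub>0. (x has_real_derivative speed t (x t)) (at t within {t\<^sub>0..})) \<and>
    (\<forall>t\<ge>t\<^sub>0. 2 * M < x t \<and> 0 < chi t (x t))"
proof -
  have init: "0 < t\<^sub>0" "2 * M < r\<^sub>0" "0 < chi t\<^sub>0 r\<^sub>0" using reg by (auto simp: regular_region_iff)
  define cl where "cl r = max (2 * M) (min r r\<^sub>0)" for r
  have cl: "2 * M \<le> cl r" "cl r \<le> r\<^sub>0" "\<bar>cl r - cl r'\<bar> \<le> \<bar>r - r'\<bar>" for r r'
    using init by (auto simp: cl_def max_def min_def)
  have in\<Omega>: "(t, cl r) \<in> \<Omega>" if "t\<^sub>0 \<le> t" for t r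
    using that init cl by (intro Omega_ge_2M) auto
  have Fcont: "continuous_on ({t\<^sub>0..} \<times> UNIV) (\<lambda>(t, r). speed t (cl r))"
  proof -
    have "continuous_on ({t\<^sub>0..} \<times> UNIV) (\<lambda>p. (\<lambda>p. speed (fst p) (snd p)) (fst p, cl (snd p)))"
    proof (rule continuous_on_compose2[OF continuous_on_speed])
      show "continuous_on ({t\<^sub>0..} \<times> UNIV) (\<lambda>p. (fst p, cl (snd p)))"
        unfolding cl_def by (intro continuous_intros)
    qed (use in\<Omega> in auto)
    then show ?thesis by (simp add: case_prod_beta)
  qed
  have Flip: "\<exists>L. \<forall>t\<in>{t\<^sub>0..T}. \<forall>r r'. \<bar>speed t (cl r) - speed t (cl r')\<bar> \<le> L * \<bar>r - r'\<bar>" for T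
  proof -
    obtain L where L: "\<And>t x y. {t} \<times> closed_segment x y \<subseteq> {t\<^sub>0..T} \<times> {2*M..r\<^sub>0} \<Longrightarrow>
        \<bar>speed t x - speed t y\<bar> \<le> L * \<bar>x - y\<bar>"
      by (rule speed_lipschitz_compact[of "{t\<^sub>0..T} \<times> {2*M..r\<^sub>0}"])
        (use init in \<open>auto intro!: compact_Times Omega_ge_2M\<close>)
    have "\<bar>speed t (cl r) - speed t (cl r')\<bar> \<le> \<bar>L\<bar> * \<bar>r - r'\<bar>" if "t \<in> {t\<^sub>0..T}" for t r r'
    proof -
      have "\<bar>speed t (cl r) - speed t (cl r')\<bar> \<le> L * \<bar>cl r - cl r'\<bar>"
      proof (rule L)
        have "closed_segment (cl r) (cl r') \<subseteq> {2*M..r\<^sub>0}"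
          by (rule closed_segment_subset) (use cl in auto)
        then show "{t} \<times> closed_segment (cl r) (cl r') \<subseteq> {t\<^sub>0..T} \<times> {2*M..r\<^sub>0}" using that by auto
      qed
      also have "\<dots> \<le> \<bar>L\<bar> * \<bar>r - r'\<bar>" by (intro mult_mono cl) auto
      finally show ?thesis .
    qed
    then show ?thesis by blast
  qed
  obtain x where x: "x t\<^sub>0 = r\<^sub>0"
    "\<And>t. t\<^sub>0 \<le> t \<Longrightarrow> (x has_real_derivative speed t (cl (x t))) (at t within {t\<^sub>0..})"
    using picard_global[OF Fcont Flip, of r\<^sub>0] by blast
  have xcont: "continuous_on {t\<^sub>0..} x"
    by (rule DERIV_continuous_on) (use x(2) in auto)
  \<comment> \<open>At the fixed radius \<open>r\<^sub>0\<close> chi only grows, so the speed there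
    stays negative and \<open>r\<^sub>0\<close> is an upper barrier.\<close>
  have chi_r0: "0 < chi t r\<^sub>0" if "t\<^sub>0 \<le> t" for t
  proof -
    have "N t \<le> N t\<^sub>0" using N_strict_antimono[of t\<^sub>0 t] init that by (cases "t = t\<^sub>0") auto
    then have "r\<^sub>0\<^sup>2 * N t \<le> r\<^sub>0\<^sup>2 * N t\<^sub>0" by (intro mult_left_mono) auto
    with init(3) show ?thesis by (simp add: chi_eq)
  qed
  have upper: "x t \<le> r\<^sub>0" if t: "t\<^sub>0 \<le> t" for t
  proof (rule ccontr)
    assume "\<not> x t \<le> r\<^sub>0"
    \<comment> \<open>Time is reversed, so that the first zero becomes the last time before t with x
      = \<open>r\<^sub>0\<close>; from then on the clamped equation uses the negative speed at
      \<open>r\<^sub>0\<close>.\<close>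
    obtain s where s: "0 < s" "s \<le> t - t\<^sub>0" "x (t - s) - r\<^sub>0 = 0"
      "\<And>\<tau>. 0 \<le> \<tau> \<Longrightarrow> \<tau> < s \<Longrightarrow> 0 < x (t - \<tau>) - r\<^sub>0"
    proof (rule first_zero[of 0 "t - t\<^sub>0" "\<lambda>\<tau>. x (t - \<tau>) - r\<^sub>0"])
      show "continuous_on {0..t - t\<^sub>0} (\<lambda>\<tau>. x (t - \<tau>) - r\<^sub>0)"
        by (intro continuous_intros continuous_on_compose2[OF xcont]) auto
    qed (use t x(1) \<open>\<not> x t \<le> r\<^sub>0\<close> in auto)
    have "t - s < t" "{t - s..t} \<subseteq> {t\<^sub>0..}" using s by auto
    moreover have "(x has_real_derivative speed \<tau> (cl (x \<tau>))) (at \<tau> within {t\<^sub>0..})" if "\<tau> \<in> {t - s..t}" for \<tau>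
      using that s by (intro x(2)) auto
    ultimately obtain z where z: "t - s < z" "z < t" "x t - x (t - s) = speed z (cl (x z)) * (t - (t - s))"
      by (rule mvt_within)
    have "r\<^sub>0 < x z" using s(4)[of "t - z"] z by auto
    then have "cl (x z) = r\<^sub>0" using init by (auto simp: cl_def)
    moreover have "speed z r\<^sub>0 < 0"
      using z s init by (intro speed_neg chi_r0 Omega_ge_2M) auto
    ultimately have "x t - x (t - s) < 0" unfolding z(3) using s(1) by (simp add: mult_neg_pos)
    with s(3) \<open>\<not> x t \<le> r\<^sub>0\<close> show False by simp
  qed
  \<comment> \<open>This is x chi with the denominator cleared, hence continuous before x is known
    to be nonzero.\<close>
  define P where "P t = x t - 2 * M - N t * x t ^ 3" for t
  have P_chi: "P t = x t * chi t (x t)" if "0 < x t" for t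
    using that by (simp add: P_def chi_eq field_simps power2_eq_square power3_eq_cube)
  have lower: "2 * M < x t \<and> 0 < P t" if t: "t\<^sub>0 \<le> t" for t
  proof (rule ccontr)
    define m where "m t = min (x t - 2 * M) (P t)" for t
    assume "\<not> (2 * M < x t \<and> 0 < P t)"
    then have "m t \<le> 0" by (auto simp: m_def)
    have Ncont: "continuous_on {t\<^sub>0..t} N"
      by (rule continuous_on_subset[OF continuous_on_N]) (use init in auto)
    have "continuous_on {t\<^sub>0..t} m"
      unfolding m_def P_def
      by (intro continuous_intros Ncont continuous_on_subset[OF xcont]) auto
    moreover have "0 < m t\<^sub>0"
      using init M_pos P_chi[of t\<^sub>0] x(1) by (simp add: m_def)
    ultimately obtain s where s: "t\<^sub>0 < s" "s \<le> t" "m s = 0" "\<And>\<tau>. t\<^sub>0 \<le> \<tau> \<Longrightarrow> \<tau> < s \<Longrightarrow> 0 < m \<tau>"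
      using first_zero[of t\<^sub>0 t m] t \<open>m t \<le> 0\<close> by blast
    \<comment> \<open>Exit through x = 2 M is excluded: there P = - N (2 M)^3 < 0, whereas the
      minimum of both quantities is 0. So P vanishes at s.\<close>
    have "0 < N s" using N_pos s init by simp
    then have "0 < N s * (2 * M) ^ 3" using M_pos by simp
    then have "x s \<noteq> 2 * M" using s(3) by (auto simp: m_def P_def)
    then have xs: "2 * M < x s" "P s = 0" using s(3) by (auto simp: m_def min_def split: if_splits)
    then have "chi s (x s) = 0" using P_chi[of s] M_pos by simp
    moreover have "(s, x s) \<in> \<Omega>" using xs s init by (intro Omega_ge_2M) auto
    moreover have "cl (x s) = x s" using xs upper[of s] s by (auto simp: cl_def)
    ultimately have "speed s (cl (x s)) = 0" by (simp add: speed_eq_chi)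
    then have x': "(x has_real_derivative 0) (at s within {t\<^sub>0..})" using x(2)[of s] s by simp
    \<comment> \<open>Since x' = 0 at s, only N contributes: P' = - N' x^3 > 0. Then P is negative
      just before s, which contradicts the choice of s as the first zero.\<close>
    have "(P has_real_derivative - (2 * H s * (H' s + b s)) * x s ^ 3) (at s within {t\<^sub>0..})"
      unfolding P_def using s init
      by (auto intro!: derivative_eq_intros x' has_field_derivative_at_within[OF DERIV_N])
    moreover have "H s * (H' s + b s) < 0"
      using NEC[of s] hubble_pos[of s] s init by (simp add: mult_pos_neg)
    then have "0 < - (2 * H s * (H' s + b s)) * x s ^ 3"
      using xs M_pos by (simp add: mult_neg_pos)
    ultimately obtain d where d: "0 < d" "\<And>h. 0 < h \<Longrightarrow> s - h \<in> {t\<^sub>0..} \<Longrightarrow> h < d \<Longrightarrow> P (s - h) < P s"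
      using has_real_derivative_pos_inc_left by blast
    define h where "h = min (d / 2) (s - t\<^sub>0)"
    have "P (s - h) < 0" using d(2)[of h] d(1) s xs by (auto simp: h_def min_def)
    moreover have "0 < m (s - h)" using s(1) d(1) by (intro s(4)) (auto simp: h_def min_def)
    ultimately show False by (auto simp: m_def)
  qed
  have cl_eq: "cl (x t) = x t" if "t\<^sub>0 \<le> t" for t
    using lower[OF that] upper[OF that] by (auto simp: cl_def max_def min_def)
  have "0 < chi t (x t)" if "t\<^sub>0 \<le> t" for t
    using lower[OF that] P_chi[of t] M_pos by (auto simp: zero_less_mult_iff)
  with x lower cl_eq show ?thesis by (intro exI[of _ x]) auto
qed

lemma ingoing_solution_tendsto:
  assumes t0: "0 < t\<^sub>0"
    and x: "\<And>t. t\<^sub>0 \<le> t \<Longrightarrow> (x has_real_derivative speed t (x t)) (at t within {t\<^sub>0..})"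
    and reg: "\<And>t. t\<^sub>0 \<le> t \<Longrightarrow> 2 * M < x t \<and> 0 < chi t (x t)"
  shows "(x \<longlongrightarrow> r_minus M a) at_top"
proof -
  have in\<Omega>: "(t, x t) \<in> \<Omega>" if "t\<^sub>0 \<le> t" for t
    using reg[OF that] t0 that by (intro Omega_ge_2M) auto
  have anti: "x v \<le> x u" if "t\<^sub>0 \<le> u" "u \<le> v" for u v
  proof (cases "u = v")
    case False
    then have "u < v" "{u..v} \<subseteq> {t\<^sub>0..}" using that by auto
    moreover have "(x has_real_derivative speed \<tau> (x \<tau>)) (at \<tau> within {t\<^sub>0..})" if "\<tau> \<in> {u..v}" for \<tau>
      using that \<open>t\<^sub>0 \<le> u\<close> by (intro x) auto
    ultimately obtain z where "u < z" "z < v" "x v - x u = speed z (x z) * (v - u)"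
      by (rule mvt_within)
    moreover have "speed z (x z) < 0" using speed_neg[OF in\<Omega>, of z] reg[of z] that \<open>u < z\<close> by auto
    ultimately show ?thesis using that mult_neg_pos[of "speed z (x z)" "v - u"] by auto
  qed simp
  obtain R where R: "(x \<longlongrightarrow> R) at_top" "\<And>t. t\<^sub>0 \<le> t \<Longrightarrow> R \<le> x t" "2 * M \<le> R"
    using antimono_tendsto_at_top[of t\<^sub>0 x "2 * M"] anti reg by (metis less_imp_le)
  define L where "L = H_inf a"
  define c where "c = 1 - 2 * M / R - R\<^sup>2 * L\<^sup>2"
  have "0 < R" using R(3) M_pos by simp
  have chi_lim: "((\<lambda>t. chi t (x t)) \<longlongrightarrow> c) at_top"
    unfolding chi_eq c_def L_def using \<open>0 < R\<close>
    by (auto intro!: tendsto_intros R N_tendsto)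
  have ev: "\<forall>\<^sub>F t in at_top. t\<^sub>0 \<le> t" by (rule eventually_ge_at_top)
  have "0 \<le> c"
    by (rule tendsto_lowerbound[OF chi_lim eventually_mono[OF ev]]) (auto intro: less_imp_le dest: reg)
  have "c = 0"
  proof (rule ccontr)
    assume "c \<noteq> 0"
    with \<open>0 \<le> c\<close> have "0 < c" by simp
    define k where "k = 1 - 2 * M / R"
    have "0 < k" using \<open>0 < c\<close> by (simp add: c_def k_def) (smt (verit) mult_nonneg_nonneg zero_le_power2)
    \<comment> \<open>\<open>J\<close> is replaced by its lower bound; g bounds the speed from above
      and tends to - \<delta>.\<close>
    define g where "g t = - (1 / sqrt (1 + b t * (x t)\<^sup>2) * sqrt (\<kappa> t (x t)) * chi t (x t) / (x t * H t + sqrt (\<kappa> t (x t))))" for t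
    define \<delta> where "\<delta> = sqrt k * c / (R * L + sqrt k)"
    have "0 \<le> L" unfolding L_def by (rule H_inf_nonneg)
    then have den: "0 < R * L + sqrt k" using \<open>0 < R\<close> \<open>0 < k\<close> by (simp add: add_nonneg_pos)
    then have "0 < \<delta>" using \<open>0 < k\<close> \<open>0 < c\<close> by (simp add: \<delta>_def)
    have "((\<lambda>t. \<kappa> t (x t)) \<longlongrightarrow> 1 - 2 * M / R + R\<^sup>2 * 0) at_top"
      unfolding kappa_eq using \<open>0 < R\<close> by (intro tendsto_intros R b_tendsto) auto
    then have klim: "((\<lambda>t. \<kappa> t (x t)) \<longlongrightarrow> k) at_top" by (simp add: k_def)
    have "(g \<longlongrightarrow> - (1 / sqrt (1 + 0 * R\<^sup>2) * sqrt k * c / (R * L + sqrt k))) at_top"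
      unfolding g_def L_def using den unfolding L_def
      by (intro tendsto_intros b_tendsto R klim chi_lim H_tendsto) auto
    then have glim: "(g \<longlongrightarrow> - \<delta>) at_top" by (simp add: \<delta>_def)
    have "\<forall>\<^sub>F t in at_top. g t < - (\<delta> / 2)"
      using order_tendstoD(2)[OF glim, of "- (\<delta> / 2)"] \<open>0 < \<delta>\<close> by simp
    then obtain T where T: "\<And>t. T \<le> t \<Longrightarrow> g t < - (\<delta> / 2)"
      by (auto simp: eventually_at_top_linorder)
    define T' where "T' = max T t\<^sub>0"
    have speed: "speed t (x t) \<le> - (\<delta> / 2)" if "T' \<le> t" for t
    proof -
      have t: "t\<^sub>0 \<le> t" "T \<le> t" using that by (auto simp: T'_def)
      note \<Omega> = Omega_D[OF in\<Omega>[OF t(1)]]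
      have "1 / sqrt (1 + b t * (x t)\<^sup>2) * (sqrt (\<kappa> t (x t)) * chi t (x t) / (x t * H t + sqrt (\<kappa> t (x t))))
          \<le> J t (x t) * (sqrt (\<kappa> t (x t)) * chi t (x t) / (x t * H t + sqrt (\<kappa> t (x t))))"
        using \<Omega> reg[OF t(1)] by (intro mult_right_mono J_ge in\<Omega> t divide_nonneg_nonneg) auto
      then have "speed t (x t) \<le> g t"
        unfolding speed_eq_chi[OF in\<Omega>[OF t(1)]] g_def by (simp add: mult.assoc)
      with T[OF t(2)] show ?thesis by simp
    qed
    \<comment> \<open>Falling at rate \<delta> / 2 or faster from time T', x would be nonpositive at
      time U.\<close>
    define U where "U = T' + 2 * x T' / \<delta>"
    have xT: "0 < x T'" using reg[of T'] M_pos by (simp add: T'_def)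
    then have "T' < U" using \<open>0 < \<delta>\<close> by (simp add: U_def)
    moreover have "{T'..U} \<subseteq> {t\<^sub>0..}" by (auto simp: T'_def)
    moreover have "(x has_real_derivative speed \<tau> (x \<tau>)) (at \<tau> within {t\<^sub>0..})" if "\<tau> \<in> {T'..U}" for \<tau>
      using that by (intro x) (auto simp: T'_def)
    ultimately obtain z where z: "T' < z" "z < U" "x U - x T' = speed z (x z) * (U - T')"
      by (rule mvt_within)
    have "x U - x T' \<le> - (\<delta> / 2) * (U - T')"
      unfolding z(3) using speed[of z] z by (intro mult_right_mono) auto
    also have "\<dots> = - x T'" using \<open>0 < \<delta>\<close> by (simp add: U_def)
    finally have "x U \<le> 0" by simp
    moreover have "t\<^sub>0 \<le> U" using \<open>T' < U\<close> by (simp add: T'_def)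
    ultimately show False using reg[of U] M_pos by simp
  qed
  have "R = r_minus M a"
  proof (cases "L = 0")
    case True
    then show ?thesis using \<open>c = 0\<close> \<open>0 < R\<close> by (simp add: c_def r_minus_def L_def field_simps)
  next
    case False
    have "(LEAST r. 0 < r \<and> 1 - 2 * M / r - r\<^sup>2 * L\<^sup>2 = 0) = R"
    proof (rule Least_equality)
      show "0 < R \<and> 1 - 2 * M / R - R\<^sup>2 * L\<^sup>2 = 0" using \<open>c = 0\<close> \<open>0 < R\<close> by (simp add: c_def)
      fix y assume y: "0 < y \<and> 1 - 2 * M / y - y\<^sup>2 * L\<^sup>2 = 0"
      show "R \<le> y"
      proof (rule ccontr)
        assume "\<not> R \<le> y"
        then have "y < R" by simp
        \<comment> \<open>The starting radius is not below R, and the limit function is positive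
          there because \<open>N t\<^sub>0\<close> exceeds \<open>L\<^sup>2\<close>.\<close>
        define z where "z = x t\<^sub>0"
        have "R \<le> z" using R(2)[of t\<^sub>0] by (simp add: z_def)
        have "0 < z" using \<open>R \<le> z\<close> \<open>0 < R\<close> by simp
        have eqy: "y - 2 * M = L\<^sup>2 * y ^ 3"
          using conjunct1[OF y] conjunct2[OF y] by (simp add: field_simps power2_eq_square power3_eq_cube)
        have eqR: "R - 2 * M = L\<^sup>2 * R ^ 3"
          using \<open>c = 0\<close> \<open>0 < R\<close> by (simp add: c_def field_simps power2_eq_square power3_eq_cube)
        have "z\<^sup>2 * L\<^sup>2 \<le> z\<^sup>2 * N t\<^sub>0" using N_gt[OF t0] by (intro mult_left_mono) (auto simp: L_def)
        then have "0 < 1 - 2 * M / z - z\<^sup>2 * L\<^sup>2"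
          using reg[of t\<^sub>0] unfolding chi_eq z_def[symmetric] by auto
        then have ltz: "L\<^sup>2 * z ^ 3 < z - 2 * M"
          using \<open>0 < z\<close> by (simp add: field_simps power2_eq_square power3_eq_cube)
        then have "R < z" using eqR \<open>R \<le> z\<close> by (cases "R = z") auto
        \<comment> \<open>The secant slope of L^2 r^3 is 1 between y and R but less than 1 between R
          and z; convexity of this cubic for r > 0 forbids that.\<close>
        have "(R - y) * (L\<^sup>2 * (R\<^sup>2 + R * y + y\<^sup>2)) = (R - y) * 1"
          using eqR eqy by (simp add: algebra_simps power2_eq_square power3_eq_cube)
        then have 1: "L\<^sup>2 * (R\<^sup>2 + R * y + y\<^sup>2) = 1" using \<open>y < R\<close> by simp
        have "(z - R) * (L\<^sup>2 * (z\<^sup>2 + z * R + R\<^sup>2)) < (z - R) * 1"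
          using eqR ltz by (simp add: algebra_simps power2_eq_square power3_eq_cube)
        then have 2: "L\<^sup>2 * (z\<^sup>2 + z * R + R\<^sup>2) < 1" using \<open>R < z\<close> by simp
        have "R\<^sup>2 + R * y + y\<^sup>2 \<le> z\<^sup>2 + z * R + R\<^sup>2"
        proof -
          have "R * y \<le> z * R" using \<open>R < z\<close> \<open>y < R\<close> y by (subst mult.commute) (intro mult_mono; simp)
          moreover have "y\<^sup>2 \<le> z\<^sup>2" using \<open>R < z\<close> \<open>y < R\<close> y by (intro power_mono) auto
          ultimately show ?thesis by simp
        qed
        then have "L\<^sup>2 * (R\<^sup>2 + R * y + y\<^sup>2) \<le> L\<^sup>2 * (z\<^sup>2 + z * R + R\<^sup>2)"
          by (intro mult_left_mono) auto
        with 1 2 show False by simp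
      qed
    qed
    with False show ?thesis by (simp add: r_minus_def L_def)
  qed
  with R(1) show ?thesis by simp
qed

end

section \<open>The affine parameter\<close>

lemma has_vector_derivative_vector_4:
  assumes "(f has_real_derivative f') (at s within I)" "(g has_real_derivative g') (at s within I)"
  shows "((\<lambda>s. vector [f s, g s, c, d] :: real^4) has_vector_derivative vector [f', g', 0, 0]) (at s within I)"
proof -
  have eq: "(vector [p, q, c, d] :: real^4) = p *\<^sub>R axis 1 1 + q *\<^sub>R axis 2 1 + c *\<^sub>R axis 3 1 + d *\<^sub>R axis 4 1" for p q c d :: real
    by (simp add: vec_eq_iff forall_4 vector_4 axis_def)
  have "((\<lambda>s. f s *\<^sub>R axis 1 1 + g s *\<^sub>R axis 2 1 + c *\<^sub>R axis 3 1 + d *\<^sub>R axis 4 1 :: real^4) has_vector_derivative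
      (f s *\<^sub>R 0 + f' *\<^sub>R axis 1 1) + (g s *\<^sub>R 0 + g' *\<^sub>R axis 2 1) + 0 + 0) (at s within I)"
    by (intro has_vector_derivative_add has_vector_derivative_scaleR assms has_vector_derivative_const)
  then show ?thesis unfolding eq by simp
qed

lemma has_real_derivative_vec_nth:
  assumes "(\<gamma> has_vector_derivative u) (at s within I)"
  shows "((\<lambda>s. \<gamma> s $ i) has_real_derivative u $ i) (at s within I)"
  using bounded_linear.has_vector_derivative[OF bounded_linear_vec_nth assms, of i]
  by (simp add: has_real_derivative_iff_has_vector_derivative)

text \<open>This also covers the endpoint 0 with its one-sided derivative: s is a limit point of the
  interval, so the derivative is unique. It makes the angular velocities of a competing geodesic
  vanish.\<close>

lemma constant_imp_derivative_0:
  fixes f :: "real \<Rightarrow> real"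
  assumes "(f has_real_derivative d) (at s within {0..<w})" "s \<in> {0..<w}" "\<And>x. x \<in> {0..<w} \<Longrightarrow> f x = f s"
  shows "d = 0"
proof -
  have "((\<lambda>_. f s) has_real_derivative d) (at s within {0..<w})"
    by (rule has_field_derivative_transform_within[OF assms(1) zero_less_one assms(2) assms(3)])
  then have d: "((\<lambda>_. f s) has_vector_derivative d) (at s within {0..<w})"
    by (simp only: has_real_derivative_iff_has_vector_derivative)
  have "s islimpt {0..<w}"
    by (rule islimpt_subset[OF islimpt_greaterThanLessThan1[of s w]]) (use assms(2) in auto)
  then have "at s within {0..<w} \<noteq> bot" by (simp only: trivial_limit_within not_not)
  from vector_derivative_unique_within[OF this d has_vector_derivative_const]
  show ?thesis .
qed

text \<open>x is a ray r(t) inside the regular region, and v is the initial value of dt/ds, which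
  fixes the scale of the affine parameter.\<close>

locale mcvittie_ingoing = mcvittie +
  fixes t\<^sub>0 v :: real and x :: "real \<Rightarrow> real"
  assumes t0_pos: "0 < t\<^sub>0" and v_pos: "0 < v"
    and x_deriv: "t\<^sub>0 \<le> t \<Longrightarrow> (x has_real_derivative speed t (x t)) (at t within {t\<^sub>0..})"
    and x_reg: "t\<^sub>0 \<le> t \<Longrightarrow> 2 * M < x t \<and> 0 < chi t (x t)"
begin

definition f where "f t = speed t (x t)"
text \<open>\<open>rate\<close> is the logarithmic \<open>t\<close>-derivative of \<open>dr/ds\<close>, so that \<open>Z\<close> and \<open>P\<close> are \<open>dr/ds\<close> and \<open>dt/ds\<close>
  as functions of \<open>t\<close>.\<close>

definition rate where "rate t = x t * (H' t + b t) / (x t * H t - sqrt (\<kappa> t (x t)))"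
definition Z where "Z t = f t\<^sub>0 * v * exp (integral {t\<^sub>0..t} rate)"
definition P where "P t = Z t / f t"

lemma in_Omega: "t\<^sub>0 \<le> t \<Longrightarrow> (t, x t) \<in> \<Omega>"
  using x_reg[of t] t0_pos by (intro Omega_ge_2M) auto

lemma f_neg: "t\<^sub>0 \<le> t \<Longrightarrow> f t < 0"
  unfolding f_def using x_reg[of t] by (intro speed_neg in_Omega) auto

lemma f_deriv:
  assumes "t\<^sub>0 \<le> t"
  shows "(f has_real_derivative speed_t t (x t) + speed_r t (x t) * f t) (at t within {t\<^sub>0..})"
proof -
  have "((\<lambda>t. (t, x t)) has_derivative (\<lambda>d. (d, f t * d))) (at t within {t\<^sub>0..})"
    using x_deriv[OF assms] unfolding has_field_derivative_def f_def[symmetric]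
    by (intro has_derivative_Pair has_derivative_ident)
  from has_derivative_compose[OF this speed_has_derivative[OF in_Omega[OF assms]]]
  have "((\<lambda>t. speed t (x t)) has_derivative (\<lambda>d. speed_t t (x t) * d + speed_r t (x t) * (f t * d))) (at t within {t\<^sub>0..})"
    by simp
  then show ?thesis unfolding has_field_derivative_def f_def[abs_def]
    by (rule has_derivative_eq_rhs) (simp add: fun_eq_iff algebra_simps)
qed

lemma x_cont: "continuous_on {t\<^sub>0..} x"
  by (rule DERIV_continuous_on) (use x_deriv in simp)

lemma rate_denominator_neg: "t\<^sub>0 \<le> t \<Longrightarrow> x t * H t - sqrt (\<kappa> t (x t)) < 0"
proof -
  assume t: "t\<^sub>0 \<le> t"
  note \<Omega> = Omega_D[OF in_Omega[OF t]]
  have "(x t * H t)\<^sup>2 < \<kappa> t (x t)" using x_reg[OF t] by (simp add: chi_def power2_eq_square)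
  then show ?thesis using real_less_rsqrt by simp
qed

text \<open>The numerator is negative by the null energy condition, the denominator by chi > 0. As
  \<open>Z\<close> is negative, this sign is the concavity of r in the affine parameter.\<close>

lemma rate_pos:
  assumes "t\<^sub>0 \<le> t"
  shows "0 < rate t"
proof -
  note \<Omega> = Omega_D[OF in_Omega[OF assms]]
  have "x t * (H' t + b t) < 0" using NEC[OF \<Omega>(1)] \<Omega>(2) by (intro mult_pos_neg)
  then show ?thesis unfolding rate_def using rate_denominator_neg[OF assms] by (intro divide_neg_neg)
qed

lemma rate_cont: "continuous_on {t\<^sub>0..} rate"
proof -
  have *: "continuous_on {t\<^sub>0..} g" if "continuous_on {0<..} g" for g :: "real \<Rightarrow> real"
    by (rule continuous_on_subset[OF that]) (use t0_pos in auto)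
  show ?thesis unfolding rate_def kappa_eq
  proof (intro continuous_intros *[OF continuous_on_H] *[OF continuous_on_b] *[OF continuous_on_deriv_H] x_cont ballI)
    fix t assume t: "t \<in> {t\<^sub>0..}"
    then show "x t \<noteq> 0" using Omega_D[OF in_Omega, of t] by auto
    show "x t * H t - sqrt (1 - 2 * M / x t + (x t)\<^sup>2 * b t) \<noteq> 0"
      using rate_denominator_neg[of t] t by (simp add: kappa_eq)
  qed
qed

text \<open>The right side is the coefficient of (dt/ds)^2 in the radial geodesic equation, so this
  identity turns that equation into dZ/dt = rate Z. The factor J sqrt(kappa) is common to both
  sides, which is why \<open>rate\<close> is free of \<open>J\<close>.\<close>

lemma f_rate:
  assumes "t\<^sub>0 \<le> t"
  shows "f t * rate t = J t (x t) * x t * sqrt (\<kappa> t (x t)) * (H' t + b t)"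
proof -
  note \<Omega> = Omega_D[OF in_Omega[OF assms]]
  have "f t = J t (x t) * sqrt (\<kappa> t (x t)) * (x t * H t - sqrt (\<kappa> t (x t)))"
    unfolding f_def speed_def using \<Omega> by (simp add: algebra_simps)
  then show ?thesis using rate_denominator_neg[OF assms] by (simp add: rate_def)
qed

lemma Z_deriv: "t\<^sub>0 \<le> t \<Longrightarrow> (Z has_real_derivative Z t * rate t) (at t within {t\<^sub>0..})"
  unfolding Z_def
  using DERIV_cmult[OF DERIV_chain2[OF DERIV_exp has_real_derivative_integral_atLeast[OF rate_cont]], of t "f t\<^sub>0 * v"]
  by (simp add: mult.assoc)

lemma Z_neg: "t\<^sub>0 \<le> t \<Longrightarrow> Z t < 0"
  using f_neg[of t\<^sub>0] v_pos by (simp add: Z_def mult_neg_pos)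

lemma P_pos: "t\<^sub>0 \<le> t \<Longrightarrow> 0 < P t"
  using Z_neg f_neg by (simp add: P_def divide_neg_neg)

lemma Z_eq: "t\<^sub>0 \<le> t \<Longrightarrow> Z t = f t * P t"
  using f_neg[of t] by (simp add: P_def)

lemma P_deriv:
  assumes "t\<^sub>0 \<le> t"
  shows "(P has_real_derivative P t * (rate t - (speed_t t (x t) + speed_r t (x t) * f t) / f t)) (at t within {t\<^sub>0..})"
proof -
  have "(P has_real_derivative (Z t * rate t * f t - Z t * (speed_t t (x t) + speed_r t (x t) * f t)) / (f t * f t)) (at t within {t\<^sub>0..})"
    unfolding P_def using f_neg[OF assms]
    by (intro DERIV_divide Z_deriv f_deriv assms) auto
  also have "(Z t * rate t * f t - Z t * (speed_t t (x t) + speed_r t (x t) * f t)) / (f t * f t) =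
      P t * (rate t - (speed_t t (x t) + speed_r t (x t) * f t) / f t)"
  proof -
    have "(z * r * F - z * D) / (F * F) = z / F * (r - D / F)" if "F \<noteq> 0" for z r F D :: real
      using that by (simp add: field_simps)
    then show ?thesis unfolding P_def using f_neg[OF assms] by simp
  qed
  finally show ?thesis .
qed

lemma P_t0: "P t\<^sub>0 = v"
  using f_neg[of t\<^sub>0] by (simp add: P_def Z_def)

text \<open>The null energy condition makes \<open>r\<close> concave in the affine parameter, so \<open>dr/ds\<close>
  stays below its initial value, while \<open>r\<close> stays positive.\<close>

lemma affine_parameter:
  "\<exists>S T w. 0 < w \<and> S t\<^sub>0 = 0 \<and> T 0 = t\<^sub>0 \<and>
    (\<forall>s\<in>{0..<w}. t\<^sub>0 \<le> T s \<and> (T has_real_derivative P (T s)) (at s within {0..<w})) \<and>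
    filterlim T at_top (at_left w) \<and>
    (\<forall>t\<ge>t\<^sub>0. (S has_real_derivative 1 / P t) (at t within {t\<^sub>0..}) \<and> S t \<in> {0..<w} \<and> T (S t) = t)"
proof -
  have c: "f t\<^sub>0 * v < 0" using f_neg[of t\<^sub>0] v_pos by (simp add: mult_neg_pos)
  have "continuous_on {t\<^sub>0..} P"
    by (rule DERIV_continuous_on) (use P_deriv in simp)
  then have h1: "continuous_on {t\<^sub>0..} (\<lambda>t. 1 / P t)"
    by (intro continuous_intros) (auto dest: P_pos)
  have h2: "0 < 1 / P t" if "t\<^sub>0 \<le> t" for t using P_pos[OF that] by simp
  \<comment> \<open>Comparison function: dr/ds <= \<open>f t\<^sub>0 * v\<close> < 0 bounds ds/dt by
    the derivative of this quotient. The parameter range is therefore at most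
    \<open>x t\<^sub>0\<close> divided by the initial size of dr/ds.\<close>
  have h3: "((\<lambda>t. x t / (f t\<^sub>0 * v)) has_real_derivative f t / (f t\<^sub>0 * v)) (at t within {t\<^sub>0..})"
    if "t\<^sub>0 \<le> t" for t
    using x_deriv[OF that] unfolding f_def[symmetric] by (rule DERIV_cdivide)
  have h4: "1 / P t \<le> f t / (f t\<^sub>0 * v)" if t: "t\<^sub>0 \<le> t" for t
  proof -
    have "0 \<le> integral {t\<^sub>0..t} rate"
      by (intro integral_nonneg integrable_continuous_real continuous_on_subset[OF rate_cont])
        (simp_all add: less_imp_le[OF rate_pos] subset_iff)
    then have 1: "1 \<le> exp (integral {t\<^sub>0..t} rate)" by simp
    have "0 < f t / (f t\<^sub>0 * v)" using c f_neg[OF t] by (simp add: divide_neg_neg)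
    then have "f t / (f t\<^sub>0 * v) / exp (integral {t\<^sub>0..t} rate) \<le> f t / (f t\<^sub>0 * v)"
      using divide_left_mono[OF 1, of "f t / (f t\<^sub>0 * v)"] by simp
    moreover have "1 / P t = f t / (f t\<^sub>0 * v) / exp (integral {t\<^sub>0..t} rate)"
      by (simp add: P_def Z_def)
    ultimately show ?thesis by simp
  qed
  have h5: "x t / (f t\<^sub>0 * v) \<le> 0" if "t\<^sub>0 \<le> t" for t
    using c Omega_D[OF in_Omega[OF that]] by (simp add: divide_nonneg_neg)
  from time_change[OF h1 h2 h3 h4 h5] show ?thesis
    unfolding divide_divide_eq_right by simp
qed

text \<open>The radial component holds because \<open>Z\<close> was built from it. The time
  component follows: dt/ds is the quotient of dr/ds by the null speed, and the acceleration identity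
  is the quotient rule for it.\<close>

lemma ingoing_geodesic:
  assumes T: "\<And>s. s \<in> {0..<w} \<Longrightarrow> t\<^sub>0 \<le> T s"
    "\<And>s. s \<in> {0..<w} \<Longrightarrow> (T has_real_derivative P (T s)) (at s within {0..<w})"
    and \<theta>: "0 < \<theta>" "\<theta> < pi"
  shows "ingoing_radial_null_geodesic_on M a {0..<w}
    (\<lambda>s. vector [T s, x (T s), \<theta>, \<phi>]) (\<lambda>s. vector [P (T s), Z (T s), 0, 0])"
proof -
  let ?\<gamma> = "\<lambda>s. vector [T s, x (T s), \<theta>, \<phi>] :: real^4"
  let ?u = "\<lambda>s. vector [P (T s), Z (T s), 0, 0] :: real^4"
  have chain: "((\<lambda>s. g (T s)) has_real_derivative g' * P (T s)) (at s within {0..<w})"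
    if "s \<in> {0..<w}" "(g has_real_derivative g') (at (T s) within {t\<^sub>0..})" for g g' s
  proof -
    have "(g has_real_derivative g') (at (T s) within T ` {0..<w})"
      by (rule has_field_derivative_subset[OF that(2)]) (use T(1) in auto)
    from DERIV_image_chain[OF this T(2)[OF that(1)]] show ?thesis by (simp add: o_def)
  qed
  have main: "?\<gamma> s \<in> mcvittie_domain M a" "(?\<gamma> has_vector_derivative ?u s) (at s within {0..<w})"
    "(?u has_vector_derivative
      (\<chi> i. - (\<Sum>j\<in>UNIV. \<Sum>k\<in>UNIV. christoffel (mcvittie_metric M a) (?\<gamma> s) i j k * ?u s $ j * ?u s $ k))) (at s within {0..<w})"
    "?u s \<bullet> (mcvittie_metric M a (?\<gamma> s) *v ?u s) = 0"
    "0 < P (T s)"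
    "Z (T s) = sigma M a (T s) (x (T s)) * (x (T s) - sqrt (\<kappa> (T s) (x (T s))) / H (T s)) * P (T s)"
    if s: "s \<in> {0..<w}" for s
  proof -
    define t where "t = T s"
    have t: "t\<^sub>0 \<le> t" using T(1)[OF s] by (simp add: t_def)
    note \<Omega> = in_Omega[OF t]
    show dom: "?\<gamma> s \<in> mcvittie_domain M a"
      using \<Omega> \<theta> by (simp add: mcvittie_domain_def vector_4 t_def)
    show "0 < P (T s)" using P_pos[OF t] by (simp add: t_def)
    show "Z (T s) = sigma M a (T s) (x (T s)) * (x (T s) - sqrt (\<kappa> (T s) (x (T s))) / H (T s)) * P (T s)"
      using Z_eq[OF t] speed_eq[OF \<Omega>] by (simp add: t_def f_def)
    have u2: "?u s $ 2 = speed t (x t) * ?u s $ 1" "?u s $ 3 = 0" "?u s $ 4 = 0"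
      using Z_eq[OF t] by (simp_all add: vector_4 t_def f_def)
    show "?u s \<bullet> (mcvittie_metric M a (?\<gamma> s) *v ?u s) = 0"
      by (rule radial_null_vector) (use u2 \<Omega> in \<open>simp_all add: vector_4 t_def\<close>)
    show "(?\<gamma> has_vector_derivative ?u s) (at s within {0..<w})"
    proof (rule has_vector_derivative_vector_4)
      show "(T has_real_derivative P (T s)) (at s within {0..<w})" by (rule T(2)[OF s])
      show "((\<lambda>s. x (T s)) has_real_derivative Z (T s)) (at s within {0..<w})"
        using chain[OF s x_deriv] t Z_eq[OF t] by (simp add: t_def f_def)
    qed
    define \<Gamma> where "\<Gamma> i = (\<Sum>j\<in>UNIV. \<Sum>k\<in>UNIV. christoffel (mcvittie_metric M a) (?\<gamma> s) i j k * ?u s $ j * ?u s $ k)" for i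
    have tx: "t = ?\<gamma> s $ 1" "x t = ?\<gamma> s $ 2" by (simp_all add: vector_4 t_def)
    note acc = radial_null_acceleration[OF dom tx u2, folded \<Gamma>_def]
    have \<Gamma>2: "- \<Gamma> 2 = Z t * rate t * P t"
      unfolding acc(1) Z_eq[OF t] using f_rate[OF t]
      by (simp add: vector_4 t_def[symmetric] power2_eq_square mult_ac)
    have \<Gamma>1': "f t * - \<Gamma> 1 = f t * (P t * (rate t - (speed_t t (x t) + speed_r t (x t) * f t) / f t) * P t)"
      using acc(2) \<Gamma>2 f_neg[OF t] unfolding f_def[symmetric] Z_eq[OF t]
      by (simp add: vector_4 t_def[symmetric] power2_eq_square field_simps)
    \<comment> \<open>In the regular region the speed is nonzero, so the factor carried along with
      the time component cancels.\<close>
    have "f t \<noteq> 0" using f_neg[OF t] by simp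
    then have \<Gamma>1: "- \<Gamma> 1 = P t * (rate t - (speed_t t (x t) + speed_r t (x t) * f t) / f t) * P t"
      using \<Gamma>1' by (rule mult_left_cancel[THEN iffD1])
    have "(\<chi> i. - \<Gamma> i) = (vector [- \<Gamma> 1, - \<Gamma> 2, 0, 0] :: real^4)"
      using acc(3,4) by (simp add: vec_eq_iff forall_4 vector_4)
    moreover have "(?u has_vector_derivative vector [- \<Gamma> 1, - \<Gamma> 2, 0, 0]) (at s within {0..<w})"
    proof (rule has_vector_derivative_vector_4)
      show "((\<lambda>s. P (T s)) has_real_derivative - \<Gamma> 1) (at s within {0..<w})"
        unfolding \<Gamma>1 using chain[OF s P_deriv] t by (simp add: t_def)
      show "((\<lambda>s. Z (T s)) has_real_derivative - \<Gamma> 2) (at s within {0..<w})"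
        unfolding \<Gamma>2 using chain[OF s Z_deriv] t by (simp add: t_def)
    qed
    ultimately show "(?u has_vector_derivative
      (\<chi> i. - (\<Sum>j\<in>UNIV. \<Sum>k\<in>UNIV. christoffel (mcvittie_metric M a) (?\<gamma> s) i j k * ?u s $ j * ?u s $ k))) (at s within {0..<w})"
      unfolding \<Gamma>_def by simp
  qed
  show ?thesis
    unfolding ingoing_radial_null_geodesic_on_def geodesic_on_def Let_def
    by (intro conjI ballI main) (simp_all only: vector_4 main)
qed

subsection \<open>Uniqueness\<close>

text \<open>Three conserved quantities pin the competitor down: r minus x(t) stays 0 by Gronwall,
  (dr/ds) / Z stays 1, and S(t) - s stays 0. They determine r as a function of t, then dt/ds, then s
  as a function of t. That the competitor remains in the regular region is a consequence of the
  first.\<close>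

lemma ingoing_geodesic_unique:
  assumes geo: "ingoing_radial_null_geodesic_on M a {0..<s\<^sub>1} \<gamma> u"
    and init: "\<gamma> 0 $ 1 = t\<^sub>0" "\<gamma> 0 $ 2 = x t\<^sub>0" "u 0 $ 1 = v"
    and S: "S t\<^sub>0 = 0" "\<And>t. t\<^sub>0 \<le> t \<Longrightarrow> (S has_real_derivative 1 / P t) (at t within {t\<^sub>0..})"
    and s: "s \<in> {0..<s\<^sub>1}"
  shows "t\<^sub>0 \<le> \<gamma> s $ 1 \<and> \<gamma> s $ 2 = x (\<gamma> s $ 1) \<and> S (\<gamma> s $ 1) = s"
proof -
  define I where "I = {0..<s\<^sub>1}"
  define \<tau> where "\<tau> s = \<gamma> s $ 1" for s
  define \<rho> where "\<rho> s = \<gamma> s $ 2" for s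
  define p where "p s = u s $ 1" for s
  define q where "q s = u s $ 2" for s
  define \<Gamma> where "\<Gamma> s i = (\<Sum>j\<in>UNIV. \<Sum>k\<in>UNIV. christoffel (mcvittie_metric M a) (\<gamma> s) i j k * u s $ j * u s $ k)" for s i
  have "0 < s\<^sub>1" using s by auto
  then have I0: "0 \<in> I" by (simp add: I_def)
  note geo' = geo[unfolded ingoing_radial_null_geodesic_on_def geodesic_on_def Let_def, folded I_def]
  have dom: "\<gamma> s \<in> mcvittie_domain M a" and vel: "(\<gamma> has_vector_derivative u s) (at s within I)"
    and acc: "(u has_vector_derivative (\<chi> i. - \<Gamma> s i)) (at s within I)" if "s \<in> I" for s
    unfolding \<Gamma>_def using bspec[OF conjunct1[OF geo'] that] by (simp_all only:)
  have ang: "\<gamma> s $ 3 = \<gamma> s' $ 3" "\<gamma> s $ 4 = \<gamma> s' $ 4" if "s \<in> I" "s' \<in> I" for s s'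
    using bspec[OF bspec[OF geo'[THEN conjunct2, THEN conjunct2, THEN conjunct1] that(1)] that(2)] by simp_all
  have p_pos: "0 < p s" if "s \<in> I" for s
    unfolding p_def
    by (rule bspec[OF geo'[THEN conjunct2, THEN conjunct2, THEN conjunct2, THEN conjunct1] that])
  have q_sigma: "q s = sigma M a (\<tau> s) (\<rho> s) * (\<rho> s - sqrt (\<kappa> (\<tau> s) (\<rho> s)) / H (\<tau> s)) * p s"
    if "s \<in> I" for s
    unfolding p_def q_def \<tau>_def \<rho>_def
    by (rule bspec[OF geo'[THEN conjunct2, THEN conjunct2, THEN conjunct2, THEN conjunct2] that])
  have \<Omega>: "(\<tau> s, \<rho> s) \<in> \<Omega>" if "s \<in> I" for s
    using dom[OF that] by (simp add: mcvittie_domain_def \<tau>_def \<rho>_def)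
  have q: "q s = speed (\<tau> s) (\<rho> s) * p s" if "s \<in> I" for s
    using q_sigma[OF that] speed_eq[OF \<Omega>[OF that]] by simp
  have \<tau>': "(\<tau> has_real_derivative p s) (at s within I)"
    and \<rho>': "(\<rho> has_real_derivative q s) (at s within I)"
    and q': "(q has_real_derivative - \<Gamma> s 2) (at s within I)"
    and p': "(p has_real_derivative - \<Gamma> s 1) (at s within I)" if "s \<in> I" for s
    unfolding \<tau>_def \<rho>_def p_def q_def
    using has_real_derivative_vec_nth[OF vel[OF that]] has_real_derivative_vec_nth[OF acc[OF that]]
    by (simp_all only: vec_lambda_beta)
  have u34: "u s $ 3 = 0" "u s $ 4 = 0" if "s \<in> I" for s
  proof -
    show "u s $ 3 = 0"
      by (rule constant_imp_derivative_0[OF has_real_derivative_vec_nth[OF vel[OF that, unfolded I_def]]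
        that[unfolded I_def] ang(1)[unfolded I_def, OF _ that[unfolded I_def]]])
    show "u s $ 4 = 0"
      by (rule constant_imp_derivative_0[OF has_real_derivative_vec_nth[OF vel[OF that, unfolded I_def]]
        that[unfolded I_def] ang(2)[unfolded I_def, OF _ that[unfolded I_def]]])
  qed
  have \<tau>_ge: "t\<^sub>0 \<le> \<tau> s" if "s \<in> I" for s
  proof (cases "s = 0")
    case True then show ?thesis using init by (simp add: \<tau>_def)
  next
    case False
    with that have "0 < s" "{0..s} \<subseteq> I" by (auto simp: I_def)
    moreover have "(\<tau> has_real_derivative p z) (at z within I)" if "z \<in> {0..s}" for z
      using that \<open>{0..s} \<subseteq> I\<close> by (intro \<tau>') auto
    ultimately obtain z where z: "0 < z" "z < s" "\<tau> s - \<tau> 0 = p z * (s - 0)"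
      by (rule mvt_within)
    have "z \<in> I" using z \<open>{0..s} \<subseteq> I\<close> by auto
    then have "0 < p z * (s - 0)" using p_pos \<open>0 < s\<close> by simp
    with z(3) init show ?thesis by (simp add: \<tau>_def)
  qed
  have chain: "((\<lambda>s. g (\<tau> s)) has_real_derivative g' * p s) (at s within I)"
    if "s \<in> I" "(g has_real_derivative g') (at (\<tau> s) within {t\<^sub>0..})" for g g' s
  proof -
    have "(g has_real_derivative g') (at (\<tau> s) within \<tau> ` I)"
      by (rule has_field_derivative_subset[OF that(2)]) (use \<tau>_ge in auto)
    from DERIV_image_chain[OF this \<tau>'[OF that(1)]] show ?thesis by (simp add: o_def)
  qed
  have \<rho>_eq: "\<rho> s = x (\<tau> s)" if "s \<in> I" for s
  proof -
    have sub: "{0..s} \<subseteq> I" using that by (auto simp: I_def)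
    have cont: "continuous_on {0..s} \<tau>" "continuous_on {0..s} \<rho>" "continuous_on {0..s} p"
      "continuous_on {0..s} (\<lambda>s. x (\<tau> s))"
      using sub by (auto intro!: continuous_on_subset[OF _ sub] DERIV_continuous_on[OF \<tau>']
          DERIV_continuous_on[OF \<rho>'] DERIV_continuous_on[OF p'] DERIV_continuous_on[OF chain[OF _ x_deriv[OF \<tau>_ge]]])
    \<comment> \<open>All radial segments between the competitor and the ray x, swept over the
      parameter interval. Compact as a continuous image, and contained in \<open>Omega\<close>
      because that set is upward closed in r.\<close>
    define K where "K = (\<lambda>z. (\<tau> (fst z), (1 - snd z) *\<^sub>R \<rho> (fst z) + snd z *\<^sub>R x (\<tau> (fst z)))) ` ({0..s} \<times> {0..1})"
    have "compact K" unfolding K_def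
    proof (intro compact_continuous_image continuous_intros)
      show "compact ({0..s} \<times> {0..1::real})" by (intro compact_Times) auto
    qed (auto intro!: continuous_intros continuous_on_compose2[OF cont(1)] continuous_on_compose2[OF cont(2)]
        continuous_on_compose2[OF cont(4)])
    moreover have "K \<subseteq> \<Omega>"
    proof
      fix z assume "z \<in> K"
      then obtain \<sigma> l where \<sigma>: "\<sigma> \<in> {0..s}" "l \<in> {0..1}"
        "z = (\<tau> \<sigma>, (1 - l) *\<^sub>R \<rho> \<sigma> + l *\<^sub>R x (\<tau> \<sigma>))" unfolding K_def by auto
      then have "\<sigma> \<in> I" using sub by auto
      have min: "(\<tau> \<sigma>, min (\<rho> \<sigma>) (x (\<tau> \<sigma>))) \<in> \<Omega>"
        using \<Omega>[OF \<open>\<sigma> \<in> I\<close>] in_Omega[OF \<tau>_ge[OF \<open>\<sigma> \<in> I\<close>]] by (simp add: min_def)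
      have "(1 - l) *\<^sub>R min (\<rho> \<sigma>) (x (\<tau> \<sigma>)) + l *\<^sub>R min (\<rho> \<sigma>) (x (\<tau> \<sigma>))
          \<le> (1 - l) *\<^sub>R \<rho> \<sigma> + l *\<^sub>R x (\<tau> \<sigma>)"
        using \<sigma>(2) by (intro add_mono scaleR_left_mono) auto
      then have "min (\<rho> \<sigma>) (x (\<tau> \<sigma>)) \<le> (1 - l) *\<^sub>R \<rho> \<sigma> + l *\<^sub>R x (\<tau> \<sigma>)"
        unfolding scaleR_add_left[symmetric] by simp
      then show "z \<in> \<Omega>" unfolding \<sigma>(3) by (rule Omega_convex_r[OF min])
    qed
    ultimately obtain L where L: "\<And>t r r'. {t} \<times> closed_segment r r' \<subseteq> K \<Longrightarrow> \<bar>speed t r - speed t r'\<bar> \<le> L * \<bar>r - r'\<bar>"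
      by (rule speed_lipschitz_compact) blast
    have "bounded (p ` {0..s})" by (intro compact_imp_bounded compact_continuous_image cont) auto
    then obtain B where B: "\<forall>y\<in>p ` {0..s}. norm y \<le> B" unfolding bounded_iff by blast
    define D where "D s = \<rho> s - x (\<tau> s)" for s
    have "D s = 0"
    proof (rule gronwall_zero[where c = s and D = D and L = "L * B"
          and D' = "\<lambda>\<sigma>. (speed (\<tau> \<sigma>) (\<rho> \<sigma>) - speed (\<tau> \<sigma>) (x (\<tau> \<sigma>))) * p \<sigma>"])
      fix \<sigma> assume \<sigma>: "\<sigma> \<in> {0..s}"
      then have "\<sigma> \<in> I" using sub by auto
      have "(D has_real_derivative q \<sigma> - speed (\<tau> \<sigma>) (x (\<tau> \<sigma>)) * p \<sigma>) (at \<sigma> within I)"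
        unfolding D_def using \<open>\<sigma> \<in> I\<close> by (intro DERIV_diff \<rho>' chain x_deriv \<tau>_ge)
      then show "(D has_real_derivative (speed (\<tau> \<sigma>) (\<rho> \<sigma>) - speed (\<tau> \<sigma>) (x (\<tau> \<sigma>))) * p \<sigma>) (at \<sigma> within {0..s})"
        using has_field_derivative_subset sub q[OF \<open>\<sigma> \<in> I\<close>] by (simp add: left_diff_distrib) blast
      have "{\<tau> \<sigma>} \<times> closed_segment (\<rho> \<sigma>) (x (\<tau> \<sigma>)) \<subseteq> K"
        unfolding K_def closed_segment_def using \<sigma> by (auto intro!: image_eqI[of _ _ "(\<sigma>, _)"])
      then have "\<bar>speed (\<tau> \<sigma>) (\<rho> \<sigma>) - speed (\<tau> \<sigma>) (x (\<tau> \<sigma>))\<bar> \<le> L * \<bar>D \<sigma>\<bar>"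
        using L by (simp add: D_def)
      moreover have "\<bar>p \<sigma>\<bar> \<le> B" using B \<sigma> by simp
      ultimately have "\<bar>speed (\<tau> \<sigma>) (\<rho> \<sigma>) - speed (\<tau> \<sigma>) (x (\<tau> \<sigma>))\<bar> * \<bar>p \<sigma>\<bar> \<le> (L * \<bar>D \<sigma>\<bar>) * B"
        by (intro mult_mono) auto
      then show "\<bar>(speed (\<tau> \<sigma>) (\<rho> \<sigma>) - speed (\<tau> \<sigma>) (x (\<tau> \<sigma>))) * p \<sigma>\<bar> \<le> (L * B) * \<bar>D \<sigma>\<bar>"
        by (simp add: abs_mult mult_ac)
    qed (use that init in \<open>auto simp: D_def I_def \<tau>_def \<rho>_def\<close>)
    then show ?thesis by (simp add: D_def)
  qed
  have q_eq: "q s = f (\<tau> s) * p s" if "s \<in> I" for s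
    using q[OF that] \<rho>_eq[OF that] by (simp add: f_def)
  have q'': "- \<Gamma> s 2 = q s * rate (\<tau> s) * p s" if "s \<in> I" for s
  proof -
    have "- \<Gamma> s 2 = (p s)\<^sup>2 * (J (\<tau> s) (\<rho> s) * \<rho> s * sqrt (\<kappa> (\<tau> s) (\<rho> s)) * (H' (\<tau> s) + b (\<tau> s)))"
      unfolding \<Gamma>_def p_def
      by (rule radial_null_acceleration(1))
        (use dom[OF that] q[OF that] u34[OF that] in \<open>simp_all add: \<tau>_def \<rho>_def p_def q_def\<close>)
    also have "\<dots> = (p s)\<^sup>2 * (f (\<tau> s) * rate (\<tau> s))"
      unfolding f_rate[OF \<tau>_ge[OF that]] \<rho>_eq[OF that] ..
    finally show ?thesis unfolding q_eq[OF that] by (simp add: power2_eq_square)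
  qed
  \<comment> \<open>Along the competitor, dr/ds and \<open>Z\<close> solve the same linear
    first-order equation, so their quotient is constant.\<close>
  have "\<exists>c. \<forall>s\<in>I. q s / Z (\<tau> s) = c"
  proof (rule has_field_derivative_zero_constant)
    fix s assume s: "s \<in> I"
    have nz: "Z (\<tau> s) \<noteq> 0" using Z_neg[OF \<tau>_ge[OF s]] by simp
    have "((\<lambda>s. q s / Z (\<tau> s)) has_real_derivative
        (- \<Gamma> s 2 * Z (\<tau> s) - q s * (Z (\<tau> s) * rate (\<tau> s) * p s)) / (Z (\<tau> s) * Z (\<tau> s))) (at s within I)"
      by (intro DERIV_divide q' chain Z_deriv \<tau>_ge s nz)
    then show "((\<lambda>s. q s / Z (\<tau> s)) has_real_derivative 0) (at s within I)"
      unfolding q''[OF s] by (simp add: mult_ac)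
  qed (simp add: I_def)
  then obtain c where c: "\<And>s. s \<in> I \<Longrightarrow> q s / Z (\<tau> s) = c" by blast
  have "f t\<^sub>0 * v \<noteq> 0" using f_neg[of t\<^sub>0] v_pos by simp
  then have "c = 1"
    using c[OF I0] q_eq[OF I0] init by (simp add: Z_def \<tau>_def p_def)
  have p_eq: "p s = P (\<tau> s)" if "s \<in> I" for s
  proof -
    have "Z (\<tau> s) \<noteq> 0" "f (\<tau> s) \<noteq> 0" using Z_neg[OF \<tau>_ge[OF that]] f_neg[OF \<tau>_ge[OF that]] by auto
    then have "f (\<tau> s) * p s = Z (\<tau> s)" using c[OF that] \<open>c = 1\<close> q_eq[OF that] by simp
    then show ?thesis unfolding P_def using \<open>f (\<tau> s) \<noteq> 0\<close> by (simp add: field_simps)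
  qed
  have "\<exists>c. \<forall>s\<in>I. S (\<tau> s) - s = c"
  proof (rule has_field_derivative_zero_constant)
    fix s assume s: "s \<in> I"
    have "((\<lambda>s. S (\<tau> s) - s) has_real_derivative 1 / P (\<tau> s) * p s - 1) (at s within I)"
      by (intro DERIV_diff chain S(2) \<tau>_ge s DERIV_ident)
    then show "((\<lambda>s. S (\<tau> s) - s) has_real_derivative 0) (at s within I)"
      unfolding p_eq[OF s] using P_pos[OF \<tau>_ge[OF s]] by simp
  qed (simp add: I_def)
  then obtain d where d: "\<And>s. s \<in> I \<Longrightarrow> S (\<tau> s) - s = d" by blast
  have "d = 0" using d[OF I0] S(1) init by (simp add: \<tau>_def)
  have "s \<in> I" using s by (simp add: I_def)
  then show ?thesis using \<tau>_ge[of s] \<rho>_eq[of s] d[of s] \<open>d = 0\<close> by (simp add: \<tau>_def \<rho>_def)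
qed

end

lemma mcvittie_if_eternally_expanding:
  assumes "eternally_expanding_mcvittie M \<Lambda> a"
  shows "mcvittie M a"
proof
  show "deriv (hubble a) t + 1 / (a t)\<^sup>2 < 0" if "0 < t" for t
  proof -
    have "0 < mu_FLRW \<Lambda> a t + P_FLRW \<Lambda> a t"
      using assms that by (simp add: eternally_expanding_mcvittie_def)
    also have "\<dots> = - (deriv (hubble a) t + 1 / (a t)\<^sup>2) / (4 * pi)"
      unfolding mu_FLRW_def P_FLRW_def by (simp add: field_simps)
    finally show ?thesis by (simp add: zero_less_divide_iff)
  qed
qed (use assms in \<open>auto simp: eternally_expanding_mcvittie_def\<close>)

theorem proposition7p2:
  fixes M \<Lambda> t\<^sub>0 r\<^sub>0 :: real and a :: "real \<Rightarrow> real"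
  assumes "eternally_expanding_mcvittie M \<Lambda> a"
    and "H_inf a > 0 \<Longrightarrow> M * H_inf a < 1 / (3 * sqrt 3)"
    and "(t\<^sub>0, r\<^sub>0) \<in> regular_region M a"
  shows "\<forall>\<theta>\<^sub>0 \<phi>\<^sub>0 v. 0 < \<theta>\<^sub>0 \<and> \<theta>\<^sub>0 < pi \<and> 0 < v \<longrightarrow>
    (\<exists>s\<^sub>\<omega>>0. \<exists>\<gamma> u.
       ingoing_radial_null_geodesic_on M a {0..<s\<^sub>\<omega>} \<gamma> u \<and>
       \<gamma> 0 = vector [t\<^sub>0, r\<^sub>0, \<theta>\<^sub>0, \<phi>\<^sub>0] \<and> u 0 $ 1 = v \<and>
       (\<forall>s\<^sub>1>0. \<forall>\<gamma>' u'.
          ingoing_radial_null_geodesic_on M a {0..<s\<^sub>1} \<gamma>' u' \<and>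
          \<gamma>' 0 = vector [t\<^sub>0, r\<^sub>0, \<theta>\<^sub>0, \<phi>\<^sub>0] \<and> u' 0 $ 1 = v \<longrightarrow>
          s\<^sub>1 \<le> s\<^sub>\<omega> \<and> (\<forall>s\<in>{0..<s\<^sub>1}. \<gamma>' s = \<gamma> s)) \<and>
       filterlim (\<lambda>s. \<gamma> s $ 1) at_top (at_left s\<^sub>\<omega>) \<and>
       ((\<lambda>s. \<gamma> s $ 2) \<longlongrightarrow> r_minus M a) (at_left s\<^sub>\<omega>))"
proof (intro allI impI)
  fix \<theta>\<^sub>0 \<phi>\<^sub>0 v :: real
  assume init: "0 < \<theta>\<^sub>0 \<and> \<theta>\<^sub>0 < pi \<and> 0 < v"
  interpret mcvittie M a by (rule mcvittie_if_eternally_expanding[OF assms(1)])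
  obtain x where x: "x t\<^sub>0 = r\<^sub>0" "\<forall>t\<ge>t\<^sub>0. (x has_real_derivative speed t (x t)) (at t within {t\<^sub>0..})"
    "\<forall>t\<ge>t\<^sub>0. 2 * M < x t \<and> 0 < chi t (x t)"
    using ingoing_solution_exists[OF assms(3)] by blast
  have "0 < t\<^sub>0" using assms(3) by (simp add: regular_region_iff)
  interpret mcvittie_ingoing M a t\<^sub>0 v x
    by standard (use x \<open>0 < t\<^sub>0\<close> init in auto)
  obtain S T w where w: "0 < w" and S0: "S t\<^sub>0 = 0" and T0: "T 0 = t\<^sub>0"
    and T: "\<forall>s\<in>{0..<w}. t\<^sub>0 \<le> T s \<and> (T has_real_derivative P (T s)) (at s within {0..<w})"
    and T_lim: "filterlim T at_top (at_left w)"
    and S: "\<forall>t\<ge>t\<^sub>0. (S has_real_derivative 1 / P t) (at t within {t\<^sub>0..}) \<and> S t \<in> {0..<w} \<and> T (S t) = t"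
    using affine_parameter by blast
  define \<gamma> where "\<gamma> s = (vector [T s, x (T s), \<theta>\<^sub>0, \<phi>\<^sub>0] :: real^4)" for s
  define u where "u s = (vector [P (T s), Z (T s), 0, 0] :: real^4)" for s
  have "ingoing_radial_null_geodesic_on M a {0..<w} \<gamma> u"
    unfolding \<gamma>_def u_def by (rule ingoing_geodesic) (use T init in auto)
  moreover have "\<gamma> 0 = vector [t\<^sub>0, r\<^sub>0, \<theta>\<^sub>0, \<phi>\<^sub>0]" by (simp add: \<gamma>_def T0 x(1))
  moreover have "u 0 $ 1 = v" by (simp add: u_def vector_4 T0 P_t0)
  moreover have "s\<^sub>1 \<le> w \<and> (\<forall>s\<in>{0..<s\<^sub>1}. \<gamma>' s = \<gamma> s)"
    if geo: "ingoing_radial_null_geodesic_on M a {0..<s\<^sub>1} \<gamma>' u'"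
      and \<gamma>0: "\<gamma>' 0 = vector [t\<^sub>0, r\<^sub>0, \<theta>\<^sub>0, \<phi>\<^sub>0]" and u0: "u' 0 $ 1 = v" and s1: "0 < s\<^sub>1" for s\<^sub>1 \<gamma>' u'
  proof -
    have uniq: "t\<^sub>0 \<le> \<gamma>' s $ 1 \<and> \<gamma>' s $ 2 = x (\<gamma>' s $ 1) \<and> S (\<gamma>' s $ 1) = s" if "s \<in> {0..<s\<^sub>1}" for s
    proof (rule ingoing_geodesic_unique[where S = S, OF geo])
      show "\<gamma>' 0 $ 1 = t\<^sub>0" "\<gamma>' 0 $ 2 = x t\<^sub>0" using \<gamma>0 x(1) by (simp_all add: vector_4)
      show "(S has_real_derivative 1 / P t) (at t within {t\<^sub>0..})" if "t\<^sub>0 \<le> t" for t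
        using S that by blast
    qed (fact u0 S0 that)+
    \<comment> \<open>Every parameter of the competitor is a value of \<open>S\<close>, and these
      lie below w; hence no such geodesic outlasts w.\<close>
    have "s < w" if "s \<in> {0..<s\<^sub>1}" for s
      using uniq[OF that] S by (metis atLeastLessThan_iff)
    then have "s\<^sub>1 \<le> w" using w by (meson atLeastLessThan_iff less_imp_le linorder_not_le order_less_irrefl)
    moreover have "\<gamma>' s = \<gamma> s" if s: "s \<in> {0..<s\<^sub>1}" for s
    proof -
      have "T s = \<gamma>' s $ 1" using uniq[OF s] S by metis
      moreover have "\<gamma>' s $ 3 = \<gamma>' 0 $ 3" "\<gamma>' s $ 4 = \<gamma>' 0 $ 4"
        using geo[unfolded ingoing_radial_null_geodesic_on_def, THEN conjunct2, THEN conjunct2, THEN conjunct1] s s1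
        by (metis atLeastLessThan_iff order_refl)+
      ultimately show ?thesis
        using uniq[OF s] by (simp add: \<gamma>_def vec_eq_iff forall_4 vector_4 \<gamma>0)
    qed
    ultimately show ?thesis by blast
  qed
  moreover have "filterlim (\<lambda>s. \<gamma> s $ 1) at_top (at_left w)"
    using T_lim by (simp add: \<gamma>_def vector_4)
  moreover have "((\<lambda>s. \<gamma> s $ 2) \<longlongrightarrow> r_minus M a) (at_left w)"
    using filterlim_compose[OF ingoing_solution_tendsto[OF \<open>0 < t\<^sub>0\<close> x_deriv x_reg] T_lim]
    by (simp add: \<gamma>_def vector_4)
  ultimately show "\<exists>s\<^sub>\<omega>>0. \<exists>\<gamma> u.
       ingoing_radial_null_geodesic_on M a {0..<s\<^sub>\<omega>} \<gamma> u \<and>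
       \<gamma> 0 = vector [t\<^sub>0, r\<^sub>0, \<theta>\<^sub>0, \<phi>\<^sub>0] \<and> u 0 $ 1 = v \<and>
       (\<forall>s\<^sub>1>0. \<forall>\<gamma>' u'.
          ingoing_radial_null_geodesic_on M a {0..<s\<^sub>1} \<gamma>' u' \<and>
          \<gamma>' 0 = vector [t\<^sub>0, r\<^sub>0, \<theta>\<^sub>0, \<phi>\<^sub>0] \<and> u' 0 $ 1 = v \<longrightarrow>
          s\<^sub>1 \<le> s\<^sub>\<omega> \<and> (\<forall>s\<in>{0..<s\<^sub>1}. \<gamma>' s = \<gamma> s)) \<and>
       filterlim (\<lambda>s. \<gamma> s $ 1) at_top (at_left s\<^sub>\<omega>) \<and>
       ((\<lambda>s. \<gamma> s $ 2) \<longlongrightarrow> r_minus M a) (at_left s\<^sub>\<omega>)"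
    using w by (intro exI[of _ w] conjI exI[of _ \<gamma>] exI[of _ u]) blast+
qed

end
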